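(* Let $d\ge 1$, let $\mu$ be a non-trivial positive measure on the unit sphere $\partial\mathbb{B}^d\subset\mathbb{C}^d$ with orthonormal polynomials $(\varphi_\alpha)_{\alpha\in\mathbb{N}_0^d}$, sharp polynomials $(\varphi_\alpha^{\#})_{\alpha\in\mathbb{N}_0^d}$ and Verblunsky coefficients $(\gamma_{\alpha,\beta})$, and put $d_{\alpha,\beta}=\sqrt{1-|\gamma_{\alpha,\beta}|^2}$. For $\alpha\in\mathbb{N}_0^d$, $\alpha\neq 0$, let $n$ be the position of $\alpha$ in the shortlex ordering (with $0$ in position $1$) and write the entries of the vector $P_{2,n}\in\mathbb{C}^{n-1}$, in order, as $P_{2,n}=[\varphi_{e_1,\alpha}^{(\beta)}]_{0\preceq\beta\preceq\mathrm{prec}(\alpha)}$. Then for every $\alpha\in\mathbb{N}_0^d$ with $\alpha\ne 0$, $$\varphi_\alpha(z)=\frac{1}{d_{0,\alpha}}\Big(\sum_{0\preceq\beta\preceq \mathrm{prec}(\alpha)}\varphi_{e_1,\alpha}^{(\beta)}\,z^{\mathrm{succ}(\beta)}\Big)-\frac{\gamma_{0,\alpha}}{d_{0,\alpha}}\,\varphi^{\#}_{\mathrm{prec}(\alpha)}(z),$$ $$\varphi_\alpha^{\#}(z)=-\frac{\overline{\gamma_{0,\alpha}}}{d_{0,\alpha}}\Big(\sum_{0\preceq\beta\preceq \mathrm{prec}(\alpha)}\varphi_{e_1,\alpha}^{(\beta)}\,z^{\mathrm{succ}(\beta)}\Big)+\frac{1}{d_{0,\alpha}}\,\varphi^{\#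}_{\mathrm{prec}(\alpha)}(z).$$
   Context: Multi-indices: for $\alpha\in\mathbb{N}_0^d$, $|\alpha|=\alpha_1+\dots+\alpha_d$ and $z^\alpha=z_1^{\alpha_1}\cdots z_d^{\alpha_d}$. The shortlex order $\prec$ on $\mathbb{N}_0^d$: $\alpha\prec\beta$ if $|\alpha|<|\beta|$, or if $|\alpha|=|\beta|$ and $\alpha_i>\beta_i$ at the first index $i$ where they differ (so $e_1\prec\dots\prec e_d$; for $d=2$: $(0,0),(1,0),(0,1),(2,0),(1,1),(0,2),\dots$). $\mathrm{prec}(\alpha)$ and $\mathrm{succ}(\alpha)$ are the immediate predecessor and successor of $\alpha$. Positive measures are finite positive Borel measures. Put $\langle p,q\rangle_\mu=\int_{\partial\mathbb{B}^d}p\,\overline{q}\,d\mu$ and $K(\alpha,\beta)=\langle z^\beta,z^\alpha\rangle_\mu$. $\mu$ is non-trivial if $[K(\alpha',\beta')]_{0\preceq\alpha',\beta'\preceq\alpha}$ is invertible for every $\alpha$. The orthonormal polynomials $\varphi_\alpha$ are obtained by applying Gram--Schmidt for $\langle\cdot,\cdot\rangle_\mu$ to the monomials in shortlex order; $\varphi_\alpha\in\mathrm{span}\{z^\beta:\beta\preceq\alpha\}$ has positive coefficient of $z^\alpha$. List $\mathbb{N}_0^d$ in shortlex order as $\alpha_1=0,\alpha_2=e_1,\alpha_3,\dots$ and for $1\le i\le j$ let $K_{i,j}=[K(\alpha_n,\alpha_m)]_{i\le n,m\le j}$. Let $K_{i,j}=F_{i,j}^*F_{i,j}=G_{i,j}^*G_{i,j}$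 with $F_{i,j}$ upper triangular, $G_{i,j}$ lower triangular, both with positive diagonal. $P_{i,j}$ is the last column of $F_{i,j}^{-1}$ and $P_{i,j}^{\#}$ is the first column of $G_{i,j}^{-1}$. The sharp polynomial $\varphi_{\alpha_n}^{\#}$ is the polynomial whose coefficient vector (with respect to $z^{\alpha_1},\dots,z^{\alpha_n}$) is $P_{1,n}^{\#}$. Verblunsky coefficients (scalar Schur--Constantinescu parameters of $K$): for $\alpha\prec\beta$ let $S=\{\delta:\alpha\prec\delta\prec\beta\}$, $M=[K(\delta,\delta')]_{\delta,\delta'\in S}$, $u=[K(\alpha,\delta)]_{\delta\in S}$ (row), $v=[K(\delta,\beta)]_{\delta\in S}$ (column), and $$\gamma_{\alpha,\beta}=\frac{K(\alpha,\beta)-uM^{-1}v}{\sqrt{K(\alpha,\alpha)-uM^{-1}u^*}\,\sqrt{K(\beta,\beta)-v^*M^{-1}v}},$$ where terms involving $M$ are omitted if $S=\emptyset$. Also $\gamma_{\alpha,\alpha}=0$ and $\gamma_{\beta,\alpha}=\overline{\gamma_{\alpha,\beta}}$. *)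

theory Defs
  imports
    "HOL-Analysis.Analysis"
    "Jordan_Normal_Form.Schur_Decomposition"
    "Jordan_Normal_Form.Gauss_Jordan_Elimination"
begin

no_notation Matrix.vec_index (infixl \<open>$\<close> 100)

section \<open>Multi-indices and the shortlex order\<close>

text \<open>
  Coordinates are indexed by a finite linearly ordered type \<open>'d\<close>, which plays the role of
  \<open>{1, \<dots>, d}\<close> with \<open>d = CARD('d) \<ge> 1\<close>. The order on \<open>'d\<close> is needed to state the shortlex order.
\<close>

type_synonym 'd multi_index = "(nat, 'd) Finite_Cartesian_Product.vec"
type_synonym 'd cspace = "(complex, 'd) Finite_Cartesian_Product.vec"

definition mdegree :: "('d::finite) multi_index \<Rightarrow> nat" where
  "mdegree \<alpha> = (\<Sum>i\<in>UNIV. \<alpha> $ i)"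

definition monomial_fun :: "('d::finite) multi_index \<Rightarrow> 'd cspace \<Rightarrow> complex" where
  "monomial_fun \<alpha> z = (\<Prod>i\<in>UNIV. (z $ i) ^ (\<alpha> $ i))"

definition shortlex :: "('d::{finite,linorder}) multi_index \<Rightarrow> 'd multi_index \<Rightarrow> bool" (infix \<open>\<prec>\<close> 50) where
  "\<alpha> \<prec> \<beta> \<longleftrightarrow> mdegree \<alpha> < mdegree \<beta> \<or>
     (mdegree \<alpha> = mdegree \<beta> \<and> (\<exists>i. \<alpha> $ i > \<beta> $ i \<and> (\<forall>j<i. \<alpha> $ j = \<beta> $ j)))"

definition shortlex_eq :: "('d::{finite,linorder}) multi_index \<Rightarrow> 'd multi_index \<Rightarrow> bool" (infix \<open>\<preceq>\<close> 50) where
  "\<alpha> \<preceq> \<beta> \<longleftrightarrow> \<alpha> \<prec> \<beta> \<or> \<alpha> = \<beta>"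

definition mi_succ :: "('d::{finite,linorder}) multi_index \<Rightarrow> 'd multi_index" where
  "mi_succ \<alpha> = (THE \<beta>. \<alpha> \<prec> \<beta> \<and> (\<forall>\<delta>. \<alpha> \<prec> \<delta> \<longrightarrow> \<beta> \<preceq> \<delta>))"

definition mi_prec :: "('d::{finite,linorder}) multi_index \<Rightarrow> 'd multi_index" where
  "mi_prec \<alpha> = (THE \<beta>. \<beta> \<prec> \<alpha> \<and> (\<forall>\<delta>. \<delta> \<prec> \<alpha> \<longrightarrow> \<delta> \<preceq> \<beta>))"

text \<open>Positions in the shortlex list start at \<open>1\<close>; \<open>mi_nth 0\<close> is meaningless and never used.\<close>

definition mi_pos :: "('d::{finite,linorder}) multi_index \<Rightarrow> nat" where
  "mi_pos \<alpha> = card {\<beta>. \<beta> \<preceq> \<alpha>}"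

definition mi_nth :: "nat \<Rightarrow> ('d::{finite,linorder}) multi_index" where
  "mi_nth n = (THE \<alpha>. mi_pos \<alpha> = n)"

section \<open>Moments of a measure on the unit sphere\<close>

definition sphere_measure :: "('d::finite) cspace measure \<Rightarrow> bool" where
  "sphere_measure \<mu> \<longleftrightarrow> sets \<mu> = sets (restrict_space borel (sphere 0 1)) \<and> finite_measure \<mu>"

definition ip :: "('d::finite) cspace measure \<Rightarrow> ('d cspace \<Rightarrow> complex)
    \<Rightarrow> ('d cspace \<Rightarrow> complex) \<Rightarrow> complex" where
  "ip \<mu> p q = (LINT z|\<mu>. p z * cnj (q z))"

definition moment :: "('d::finite) cspace measure \<Rightarrow> 'd multi_index \<Rightarrow> 'd multi_index \<Rightarrow> complex" where
  "moment \<mu> \<alpha> \<beta> = ip \<mu> (monomial_fun \<beta>) (monomial_fun \<alpha>)"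

text \<open>
  The block \<open>K\<^bsub>i,j\<^esub>\<close>. The list positions \<open>i, \<dots>, j\<close> become the matrix indices \<open>0, \<dots>, j - i\<close>;
  the matrix is empty for \<open>j < i\<close>.
\<close>

definition moment_mat ::
    "('d::{finite,linorder}) cspace measure \<Rightarrow> nat \<Rightarrow> nat \<Rightarrow> complex mat" where
  "moment_mat \<mu> i j = Matrix.mat (j + 1 - i) (j + 1 - i)
     (\<lambda>(r, c). moment \<mu> (mi_nth (i + r)) (mi_nth (i + c)))"

definition nontrivial_measure :: "('d::{finite,linorder}) cspace measure \<Rightarrow> bool" where
  "nontrivial_measure \<mu> \<longleftrightarrow> (\<forall>\<alpha>::'d multi_index. invertible_mat (moment_mat \<mu> 1 (mi_pos \<alpha>)))"

section \<open>Orthonormal polynomials\<close>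

text \<open>Gram--Schmidt applied to the list of monomials in shortlex order.\<close>

fun orthonormal_seq ::
    "('d::{finite,linorder}) cspace measure \<Rightarrow> nat \<Rightarrow> 'd cspace \<Rightarrow> complex" where
  "orthonormal_seq \<mu> n =
     (let m = monomial_fun (mi_nth n);
          p = (\<lambda>z. m z - (\<Sum>k\<in>{1..<n}. ip \<mu> m (orthonormal_seq \<mu> k) * orthonormal_seq \<mu> k z))
      in (\<lambda>z. p z / csqrt (ip \<mu> p p)))"

declare orthonormal_seq.simps [simp del]

definition orthonormal_poly ::
    "('d::{finite,linorder}) cspace measure \<Rightarrow> 'd multi_index \<Rightarrow> 'd cspace \<Rightarrow> complex" where
  "orthonormal_poly \<mu> \<alpha> = orthonormal_seq \<mu> (mi_pos \<alpha>)"

section \<open>Triangular factors and sharp polynomials\<close>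

text \<open>In the order on \<open>complex\<close>, \<open>0 < c\<close> says that \<open>c\<close> is real and positive.\<close>

definition upper_factor :: "complex mat \<Rightarrow> complex mat" where
  "upper_factor A = (THE F. F \<in> carrier_mat (dim_row A) (dim_row A) \<and> upper_triangular F
     \<and> (\<forall>k<dim_row A. 0 < F $$ (k, k)) \<and> A = mat_adjoint F * F)"

definition lower_factor :: "complex mat \<Rightarrow> complex mat" where
  "lower_factor A = (THE G. G \<in> carrier_mat (dim_row A) (dim_row A) \<and> upper_triangular (G\<^sup>T)
     \<and> (\<forall>k<dim_row A. 0 < G $$ (k, k)) \<and> A = mat_adjoint G * G)"

definition P_vec ::
    "('d::{finite,linorder}) cspace measure \<Rightarrow> nat \<Rightarrow> nat \<Rightarrow> complex Matrix.vec" where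
  "P_vec \<mu> i j = col (the (mat_inverse (upper_factor (moment_mat \<mu> i j)))) (j - i)"

definition P_sharp_vec ::
    "('d::{finite,linorder}) cspace measure \<Rightarrow> nat \<Rightarrow> nat \<Rightarrow> complex Matrix.vec" where
  "P_sharp_vec \<mu> i j = col (the (mat_inverse (lower_factor (moment_mat \<mu> i j)))) 0"

definition sharp_poly ::
    "('d::{finite,linorder}) cspace measure \<Rightarrow> 'd multi_index \<Rightarrow> 'd cspace \<Rightarrow> complex" where
  "sharp_poly \<mu> \<alpha> z =
     (\<Sum>k\<in>{1..mi_pos \<alpha>}. vec_index (P_sharp_vec \<mu> 1 (mi_pos \<alpha>)) (k - 1) * monomial_fun (mi_nth k) z)"

text \<open>
  The coefficient \<open>\<phi>\<^bsub>e\<^sub>1,\<alpha>\<^esub>\<^bsup>(\<beta>)\<^esup>\<close>: the entries of \<open>P\<^bsub>2,n\<^esub>\<close>, \<open>n\<close> the position of \<open>\<alpha>\<close>, listed by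
  \<open>0 \<preceq> \<beta> \<preceq> prec(\<alpha>)\<close> (so that the entry of \<open>\<beta>\<close> belongs to the monomial \<open>succ(\<beta>)\<close>).
\<close>

definition e1_coeff ::
    "('d::{finite,linorder}) cspace measure \<Rightarrow> 'd multi_index \<Rightarrow> 'd multi_index \<Rightarrow> complex" where
  "e1_coeff \<mu> \<alpha> \<beta> = vec_index (P_vec \<mu> 2 (mi_pos \<alpha>)) (mi_pos \<beta> - 1)"

section \<open>Verblunsky coefficients\<close>

text \<open>
  For \<open>\<alpha> \<prec> \<beta>\<close> the set \<open>S = {\<delta>. \<alpha> \<prec> \<delta> \<prec> \<beta>}\<close> is listed by the positions strictly between those
  of \<open>\<alpha>\<close> and \<open>\<beta>\<close>. The radicands are nonnegative reals, for which \<open>csqrt\<close> is the usual root.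
\<close>

definition verblunsky_less ::
    "('d::{finite,linorder}) cspace measure \<Rightarrow> 'd multi_index \<Rightarrow> 'd multi_index \<Rightarrow> complex" where
  "verblunsky_less \<mu> \<alpha> \<beta> =
    (let K = moment \<mu>; a = mi_pos \<alpha>; b = mi_pos \<beta>; s = b - a - 1;
         Minv = the (mat_inverse (moment_mat \<mu> (a + 1) (b - 1)));
         u = Matrix.vec s (\<lambda>k. K \<alpha> (mi_nth (a + 1 + k)));
         v = Matrix.vec s (\<lambda>k. K (mi_nth (a + 1 + k)) \<beta>);
         form = (\<lambda>x y. if {\<delta>. \<alpha> \<prec> \<delta> \<and> \<delta> \<prec> \<beta>} = {} then 0 else scalar_prod x (Minv *\<^sub>v y))
     in (K \<alpha> \<beta> - form u v) /
        (csqrt (K \<alpha> \<alpha> - form u (conjugate u)) * csqrt (K \<beta> \<beta> - form (conjugate v) v)))"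

definition verblunsky ::
    "('d::{finite,linorder}) cspace measure \<Rightarrow> 'd multi_index \<Rightarrow> 'd multi_index \<Rightarrow> complex" where
  "verblunsky \<mu> \<alpha> \<beta> =
    (if \<alpha> \<prec> \<beta> then verblunsky_less \<mu> \<alpha> \<beta>
     else if \<alpha> = \<beta> then 0
     else cnj (verblunsky_less \<mu> \<beta> \<alpha>))"

definition verblunsky_defect ::
    "('d::{finite,linorder}) cspace measure \<Rightarrow> 'd multi_index \<Rightarrow> 'd multi_index \<Rightarrow> real" where
  "verblunsky_defect \<mu> \<alpha> \<beta> = sqrt (1 - (cmod (verblunsky \<mu> \<alpha> \<beta>))\<^sup>2)"

end

theory Submission
  imports Defs
begin

text \<open>
  Number the monomials by their position in the shortlex order and let \<open>n\<close> be the position of \<open>\<alpha>\<close>.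
  Three kinds of polynomials enter, and each is characterized in the same way: it lies in the span of
  a block of consecutive monomials, is orthogonal to all of them except one, has norm \<open>1\<close>, and has a
  positive coefficient at the exceptional one. For \<open>\<phi>\<^sub>\<alpha>\<close> the block is \<open>1, \<dots>, n\<close> and the
  exceptional position is the last; for the sharp polynomial of \<open>\<alpha>\<close> it is the same block with the
  first position; for the polynomial \<open>\<psi>\<close> with coefficient vector \<open>P\<^bsub>2,n\<^esub>\<close>, which is the sum
  in the theorem, the block is \<open>2, \<dots>, n\<close> and the position is the last. This characterization is
  the predicate \<open>dual_unit\<close>; positivity of the moment matrices, which follows from invertibility,
  makes such a vector unique (\<open>dual_unit_unique\<close>).

  Write \<open>\<sigma>\<close> for the sharp polynomial of \<open>prec(\<alpha>)\<close>. Both \<open>\<psi>\<close> and \<open>\<sigma>\<close> are unit vectors orthogonal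
  to the interior monomials \<open>2, \<dots>, n - 1\<close>, and so are \<open>\<phi>\<^sub>\<alpha>\<close> and the sharp polynomial of \<open>\<alpha>\<close>. In
  the span of the first \<open>n\<close> monomials the orthogonal complement of the interior is a plane, and
  inside it \<open>\<phi>\<^sub>\<alpha>\<close> is orthogonal to \<open>\<sigma>\<close>, whereas the sharp polynomial is orthogonal to \<open>\<psi>\<close>. One Gram--Schmidt step therefore gives
  \<open>\<phi>\<^sub>\<alpha> = (\<psi> - g \<sigma>) / d\<close> and \<open>(\<sigma> - cnj g \<psi>) / d\<close> for the sharp polynomial, where
  \<open>g\<close> is the inner product of \<open>\<psi>\<close> with \<open>\<sigma>\<close> and \<open>d\<^sup>2 = 1 - \<bar>g\<bar>\<^sup>2\<close> (\<open>dual_unit_recursion\<close>).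

  It remains to see that the objects as defined have these properties. Eliminating the interior
  identifies \<open>g\<close> with the Verblunsky coefficient (\<open>verblunsky_dual_unit\<close>). Columns of inverse
  triangular factors are dual vectors (\<open>dual_unit_P_vec\<close>, \<open>dual_unit_P_sharp_vec\<close>), which
  requires existence and uniqueness of the triangular factorizations; and Gram--Schmidt produces
  the orthonormal polynomials (\<open>orthonormal_seq_dual_unit\<close>).
\<close>

(* The symbol is reserved for the shortlex order. *)
no_notation lesspoll (infixl \<open>\<prec>\<close> 50)

section \<open>The shortlex order as an enumeration by positive integers\<close>

lemma mdegree_shortlex_mono: "\<alpha> \<preceq> \<beta> \<Longrightarrow> mdegree \<alpha> \<le> mdegree \<beta>"
  by (auto simp: shortlex_eq_def shortlex_def)

lemma shortlex_irrefl: "\<not> \<alpha> \<prec> \<alpha>"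
  by (auto simp: shortlex_def)

lemma shortlex_trans:
  assumes "\<alpha> \<prec> \<beta>" "\<beta> \<prec> \<gamma>"
  shows "\<alpha> \<prec> \<gamma>"
proof (cases "mdegree \<alpha> = mdegree \<beta> \<and> mdegree \<beta> = mdegree \<gamma>")
  case False
  then show ?thesis using assms by (auto simp: shortlex_def)
next
  case True
  then obtain i k where i: "\<alpha> $ i > \<beta> $ i" "\<And>j. j < i \<Longrightarrow> \<alpha> $ j = \<beta> $ j"
    and k: "\<beta> $ k > \<gamma> $ k" "\<And>j. j < k \<Longrightarrow> \<beta> $ j = \<gamma> $ j"
    using assms unfolding shortlex_def by (metis less_irrefl)
  have "\<alpha> $ (min i k) > \<gamma> $ (min i k)"
    using i(1) k(1) i(2)[of k] k(2)[of i] by (cases i k rule: linorder_cases) auto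
  moreover have "\<And>j. j < min i k \<Longrightarrow> \<alpha> $ j = \<gamma> $ j"
    using i(2) k(2) by auto
  ultimately show ?thesis
    using True unfolding shortlex_def by metis
qed

lemma shortlex_total:
  fixes \<alpha> \<beta> :: "('d::{finite,linorder}) multi_index"
  assumes "\<alpha> \<noteq> \<beta>"
  shows "\<alpha> \<prec> \<beta> \<or> \<beta> \<prec> \<alpha>"
proof -
  define D where "D = {i. \<alpha> $ i \<noteq> \<beta> $ i}"
  define m where "m = Min D"
  have "D \<noteq> {}"
    using assms by (auto simp: D_def Finite_Cartesian_Product.vec_eq_iff)
  then have "m \<in> D"
    unfolding m_def by (rule Min_in[OF finite])
  then have "\<alpha> $ m \<noteq> \<beta> $ m"
    by (simp add: D_def)
  moreover have "\<alpha> $ j = \<beta> $ j" if "j < m" for j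
  proof (rule ccontr)
    assume "\<alpha> $ j \<noteq> \<beta> $ j"
    then have "m \<le> j"
      unfolding m_def by (intro Min_le[OF finite]) (simp add: D_def)
    with that show False by simp
  qed
  ultimately show ?thesis
    unfolding shortlex_def by (metis linorder_neqE_nat)
qed

lemma finite_bounded_mdegree: "finite {\<beta> :: ('d::finite) multi_index. mdegree \<beta> \<le> N}"
proof -
  have "\<beta> $ i \<le> N" if "mdegree \<beta> \<le> N" for \<beta> :: "'d multi_index" and i
    using that member_le_sum[of i UNIV "\<lambda>i. \<beta> $ i"] by (simp add: mdegree_def)
  then have "{\<beta> :: 'd multi_index. mdegree \<beta> \<le> N} \<subseteq> vec_lambda ` (PiE UNIV (\<lambda>_. {..N}))"
    by (force intro!: image_eqI[of _ _ "vec_nth _"] simp: vec_nth_inverse)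
  then show ?thesis
    by (rule finite_subset) (intro finite_imageI finite_PiE, auto)
qed

lemma finite_shortlex_initial: "finite {\<beta>. \<beta> \<preceq> (\<alpha> :: ('d::{finite,linorder}) multi_index)}"
  by (rule finite_subset[OF _ finite_bounded_mdegree[of "mdegree \<alpha>"]])
    (auto dest: mdegree_shortlex_mono)

lemma infinite_multi_index: "infinite (UNIV :: ('d::finite) multi_index set)"
proof -
  have "inj (\<lambda>n. vec_lambda (\<lambda>_. n) :: 'd multi_index)"
    by (auto simp: inj_def Finite_Cartesian_Product.vec_eq_iff)
  then show ?thesis
    using infinite_UNIV_nat finite_subset[OF subset_UNIV] finite_image_iff by blast
qed

lemma mi_pos_less:
  assumes "\<alpha> \<prec> \<beta>"
  shows "mi_pos \<alpha> < mi_pos \<beta>"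
proof -
  have "{\<delta>. \<delta> \<preceq> \<alpha>} \<subseteq> {\<delta>. \<delta> \<preceq> \<beta>}"
    using assms shortlex_trans unfolding shortlex_eq_def by blast
  moreover have "\<not> \<beta> \<preceq> \<alpha>"
    using assms shortlex_trans shortlex_irrefl unfolding shortlex_eq_def by metis
  moreover have "\<beta> \<preceq> \<beta>"
    by (simp add: shortlex_eq_def)
  ultimately have "{\<delta>. \<delta> \<preceq> \<alpha>} \<subset> {\<delta>. \<delta> \<preceq> \<beta>}"
    by blast
  then show ?thesis
    unfolding mi_pos_def by (rule psubset_card_mono[OF finite_shortlex_initial])
qed

text \<open>
  Positions turn every question about the shortlex order, including the definite descriptions of
  successor, predecessor and \<open>n\<close>-th multi-index, into one about natural numbers.
\<close>

lemma shortlex_iff_mi_pos: "\<alpha> \<prec> \<beta> \<longleftrightarrow> mi_pos \<alpha> < mi_pos \<beta>"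
proof
  assume less: "mi_pos \<alpha> < mi_pos \<beta>"
  then have "\<alpha> \<noteq> \<beta>" by auto
  moreover have "\<not> \<beta> \<prec> \<alpha>"
    using less mi_pos_less[of \<beta> \<alpha>] by linarith
  ultimately show "\<alpha> \<prec> \<beta>"
    using shortlex_total[of \<alpha> \<beta>] by simp
qed (rule mi_pos_less)

lemma mi_pos_eq_iff [simp]: "mi_pos \<alpha> = mi_pos \<beta> \<longleftrightarrow> \<alpha> = \<beta>"
proof
  assume eq: "mi_pos \<alpha> = mi_pos \<beta>"
  then have "\<not> \<alpha> \<prec> \<beta>" "\<not> \<beta> \<prec> \<alpha>"
    by (simp_all add: shortlex_iff_mi_pos)
  then show "\<alpha> = \<beta>"
    using shortlex_total by blast
qed simp

lemma shortlex_eq_iff_mi_pos: "\<alpha> \<preceq> \<beta> \<longleftrightarrow> mi_pos \<alpha> \<le> mi_pos \<beta>"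
  by (auto simp: shortlex_eq_def shortlex_iff_mi_pos order_le_less)

lemma mi_pos_ge_1: "1 \<le> mi_pos \<alpha>"
  using finite_shortlex_initial[of \<alpha>]
  by (auto simp: mi_pos_def Suc_le_eq card_gt_0_iff shortlex_eq_def)

lemma mi_pos_zero: "mi_pos (0 :: ('d::{finite,linorder}) multi_index) = 1"
proof -
  have "\<beta> = 0" if "\<beta> \<preceq> (0 :: 'd multi_index)" for \<beta>
    using mdegree_shortlex_mono[OF that]
    by (simp add: mdegree_def Finite_Cartesian_Product.vec_eq_iff)
  then have "{\<beta>. \<beta> \<preceq> (0 :: 'd multi_index)} = {0}"
    by (auto simp: shortlex_eq_def)
  then show ?thesis by (simp add: mi_pos_def)
qed

text \<open>
  Initial segments are finite and there are infinitely many multi-indices, so some element lies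
  above \<open>\<alpha>\<close>; the one with the least position has exactly one more element below it than \<open>\<alpha>\<close>.
\<close>

lemma mi_pos_successor:
  fixes \<alpha> :: "('d::{finite,linorder}) multi_index"
  shows "\<exists>\<beta> :: 'd multi_index. mi_pos \<beta> = Suc (mi_pos \<alpha>)"
proof -
  obtain \<delta> where "\<not> \<delta> \<preceq> \<alpha>"
    using ex_new_if_finite[OF infinite_multi_index finite_shortlex_initial[of \<alpha>]] by auto
  then have ex: "mi_pos \<alpha> < mi_pos \<delta>"
    by (simp add: shortlex_eq_iff_mi_pos)
  obtain \<beta> :: "'d multi_index" where b: "mi_pos \<alpha> < mi_pos \<beta>"
    "\<And>\<delta> :: 'd multi_index. mi_pos \<alpha> < mi_pos \<delta> \<Longrightarrow> mi_pos \<beta> \<le> mi_pos \<delta>"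
    using ex_has_least_nat[of "\<lambda>\<delta>. mi_pos \<alpha> < mi_pos \<delta>" \<delta> mi_pos, OF ex] by blast
  have "{\<delta>. \<delta> \<preceq> \<beta>} = insert \<beta> {\<delta>. \<delta> \<preceq> \<alpha>}"
  proof (intro equalityI subsetI)
    fix \<delta> assume "\<delta> \<in> {\<delta>. \<delta> \<preceq> \<beta>}"
    then have "mi_pos \<delta> \<le> mi_pos \<beta>" by (simp add: shortlex_eq_iff_mi_pos)
    then show "\<delta> \<in> insert \<beta> {\<delta>. \<delta> \<preceq> \<alpha>}"
      using b(2)[of \<delta>] by (auto simp: shortlex_eq_iff_mi_pos not_less)
  qed (use b(1) in \<open>auto simp: shortlex_eq_iff_mi_pos\<close>)
  moreover have "\<not> \<beta> \<preceq> \<alpha>"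
    using b(1) by (simp add: shortlex_eq_iff_mi_pos)
  ultimately have "mi_pos \<beta> = Suc (mi_pos \<alpha>)"
    using finite_shortlex_initial[of \<alpha>] by (simp add: mi_pos_def)
  then show ?thesis ..
qed

lemma mi_pos_surj: "1 \<le> n \<Longrightarrow> \<exists>\<alpha> :: ('d::{finite,linorder}) multi_index. mi_pos \<alpha> = n"
proof (induction n rule: dec_induct)
  case base
  show ?case by (rule exI[of _ 0]) (rule mi_pos_zero)
next
  case (step n)
  then show ?case using mi_pos_successor by auto
qed

lemma mi_pos_nth: "1 \<le> n \<Longrightarrow> mi_pos (mi_nth n) = n"
  unfolding mi_nth_def by (rule theI', rule ex_ex1I) (auto simp: mi_pos_surj simp flip: mi_pos_eq_iff)

lemma mi_nth_pos [simp]: "mi_nth (mi_pos \<alpha>) = \<alpha>"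
  by (rule mi_pos_eq_iff[THEN iffD1], rule mi_pos_nth[OF mi_pos_ge_1])

lemma mi_pos_succ:
  fixes \<alpha> :: "('d::{finite,linorder}) multi_index"
  shows "mi_pos (mi_succ \<alpha>) = Suc (mi_pos \<alpha>)"
proof -
  obtain \<beta> :: "'d multi_index" where b: "mi_pos \<beta> = Suc (mi_pos \<alpha>)"
    using mi_pos_successor by blast
  have "mi_succ \<alpha> = \<beta>"
    unfolding mi_succ_def shortlex_iff_mi_pos shortlex_eq_iff_mi_pos
  proof (rule the_equality)
    fix \<gamma> :: "'d multi_index" assume g: "mi_pos \<alpha> < mi_pos \<gamma> \<and> (\<forall>\<delta> :: 'd multi_index. mi_pos \<alpha> < mi_pos \<delta> \<longrightarrow> mi_pos \<gamma> \<le> mi_pos \<delta>)"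
    have "mi_pos \<alpha> < mi_pos \<beta>" using b by simp
    with g have "mi_pos \<gamma> \<le> mi_pos \<beta>" by blast
    with g b have "mi_pos \<gamma> = mi_pos \<beta>" by linarith
    then show "\<gamma> = \<beta>" by simp
  qed (use b in auto)
  with b show ?thesis by simp
qed

lemma mi_pos_prec:
  fixes \<alpha> :: "('d::{finite,linorder}) multi_index"
  assumes "1 < mi_pos \<alpha>"
  shows "mi_pos (mi_prec \<alpha>) = mi_pos \<alpha> - 1"
proof -
  have "1 \<le> mi_pos \<alpha> - 1"
    using assms by simp
  then obtain \<beta> :: "'d multi_index" where b: "mi_pos \<beta> = mi_pos \<alpha> - 1"
    using mi_pos_surj by blast
  have "mi_prec \<alpha> = \<beta>"
    unfolding mi_prec_def shortlex_iff_mi_pos shortlex_eq_iff_mi_pos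
  proof (rule the_equality)
    fix \<gamma> :: "'d multi_index" assume g: "mi_pos \<gamma> < mi_pos \<alpha> \<and> (\<forall>\<delta> :: 'd multi_index. mi_pos \<delta> < mi_pos \<alpha> \<longrightarrow> mi_pos \<delta> \<le> mi_pos \<gamma>)"
    have "mi_pos \<beta> < mi_pos \<alpha>" using assms b by simp
    with g have "mi_pos \<beta> \<le> mi_pos \<gamma>" by blast
    with g b have "mi_pos \<gamma> = mi_pos \<beta>" by linarith
    then show "\<gamma> = \<beta>" by simp
  qed (use b assms in auto)
  with b show ?thesis by simp
qed

section \<open>Unit vectors of a dual basis and their Szego recursion\<close>

text \<open>
  Gram matrices are kept as kernels \<open>H\<close> on an index type, and vectors as coefficient functions
  \<open>x\<close>; sums over a finite index set \<open>I\<close> select the block in question. This allows blocks with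
  different index ranges to be compared without shifting indices. The kernel is conjugate linear in
  its first argument: \<open>H r k\<close> is the inner product of the \<open>k\<close>-th with the \<open>r\<close>-th basis vector.
\<close>

definition hermitian :: "('i \<Rightarrow> 'i \<Rightarrow> complex) \<Rightarrow> bool" where
  "hermitian H \<longleftrightarrow> (\<forall>i j. H j i = cnj (H i j))"

definition posdef_on :: "'i set \<Rightarrow> ('i \<Rightarrow> 'i \<Rightarrow> complex) \<Rightarrow> bool" where
  "posdef_on I H \<longleftrightarrow> (\<forall>x. (\<exists>i\<in>I. x i \<noteq> 0) \<longrightarrow> 0 < (\<Sum>r\<in>I. \<Sum>k\<in>I. cnj (x r) * H r k * x k))"

text \<open>
  If \<open>H\<close> is the Gram matrix of basis vectors \<open>v\<^sub>i\<close>, \<open>i \<in> I\<close>, then \<open>x\<close> is the coefficient vector of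
  a vector orthogonal to every \<open>v\<^sub>r\<close> with \<open>r \<noteq> l\<close>, that is, of a multiple of the \<open>l\<close>-th
  element of the dual basis. The norming \<open>c * x l = 1\<close> makes it a unit vector with positive
  \<open>l\<close>-th coordinate, because its squared norm is \<open>cnj (x l) * c\<close>. Orthonormal polynomials, sharp
  polynomials and the vectors \<open>P\<^bsub>i,j\<^esub>\<close> all are instances.
\<close>

definition dual_unit :: "('i \<Rightarrow> 'i \<Rightarrow> complex) \<Rightarrow> 'i set \<Rightarrow> 'i \<Rightarrow> ('i \<Rightarrow> complex) \<Rightarrow> bool" where
  "dual_unit H I l x \<longleftrightarrow> (\<exists>c::real. 0 < c \<and> of_real c * x l = 1 \<and>
     (\<forall>r\<in>I. (\<Sum>k\<in>I. H r k * x k) = (if r = l then of_real c else 0)))"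

lemma form_rows:
  "(\<Sum>r\<in>I. \<Sum>k\<in>I. cnj (x r) * H r k * x k) = (\<Sum>r\<in>I. cnj (x r) * (\<Sum>k\<in>I. H r k * x k))"
  by (simp only: sum_distrib_left mult.assoc)

lemma pos_complex_iff: "0 < (c::complex) \<longleftrightarrow> (\<exists>r::real. 0 < r \<and> c = of_real r)"
  by (auto simp: less_complex_def complex_eq_iff)

lemma posdef_on_kernel:
  assumes "posdef_on I H" and "\<And>r. r \<in> I \<Longrightarrow> (\<Sum>k\<in>I. H r k * x k) = 0" and "i \<in> I"
  shows "x i = 0"
proof (rule ccontr)
  assume "x i \<noteq> 0"
  then have "0 < (\<Sum>r\<in>I. \<Sum>k\<in>I. cnj (x r) * H r k * x k)"
    using assms(1,3) unfolding posdef_on_def by blast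
  also have "\<dots> = (\<Sum>r\<in>I. cnj (x r) * (\<Sum>k\<in>I. H r k * x k))"
    by (rule form_rows)
  also have "\<dots> = 0"
    by (rule sum.neutral) (simp add: assms(2))
  finally show False by simp
qed

text \<open>
  The rows determine \<open>x\<close> up to the factor \<open>c\<close>, and the norming determines the positive number \<open>c\<close>.
  Every later identification of two polynomials is an appeal to this uniqueness.
\<close>

lemma dual_unit_unique:
  assumes pd: "posdef_on I H" and l: "l \<in> I"
    and x: "dual_unit H I l x" and y: "dual_unit H I l y" and i: "i \<in> I"
  shows "x i = y i"
proof -
  obtain c where c: "0 < c" "of_real c * x l = 1"
    "\<And>r. r \<in> I \<Longrightarrow> (\<Sum>k\<in>I. H r k * x k) = (if r = l then of_real c else 0)"
    using x unfolding dual_unit_def by blast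
  obtain d where d: "0 < d" "of_real d * y l = 1"
    "\<And>r. r \<in> I \<Longrightarrow> (\<Sum>k\<in>I. H r k * y k) = (if r = l then of_real d else 0)"
    using y unfolding dual_unit_def by blast
  define z where "z = (\<lambda>k. of_real d * x k - of_real c * y k)"
  have "(\<Sum>k\<in>I. H r k * z k) = 0" if "r \<in> I" for r
  proof -
    have "(\<Sum>k\<in>I. H r k * z k) = of_real d * (\<Sum>k\<in>I. H r k * x k) - of_real c * (\<Sum>k\<in>I. H r k * y k)"
      by (simp add: z_def algebra_simps sum_subtractf sum_distrib_left)
    then show ?thesis using c(3)[OF that] d(3)[OF that] by simp
  qed
  then have z: "z k = 0" if "k \<in> I" for k
    using posdef_on_kernel[OF pd] that by blast
  have "of_real (d * d) * (of_real c * x l) = of_real (c * c) * (of_real d * y l)"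
    using z[OF l] by (simp add: z_def algebra_simps)
  then have "complex_of_real (d * d) = of_real (c * c)"
    by (simp only: c(2) d(2) mult_1_right)
  then have "d\<^sup>2 = c\<^sup>2"
    by (simp only: of_real_eq_iff power2_eq_square)
  then have "c = d"
    using c(1) d(1) by (simp add: power2_eq_iff_nonneg)
  then show ?thesis
    using z[OF i] c(1) by (simp add: z_def)
qed

lemma sum_delta_out:
  assumes "finite J" "b \<notin> J"
  shows "(\<Sum>k\<in>insert b J. f k * (if k = b then 0 else x k)) = (\<Sum>k\<in>J. f k * x k :: complex)"
proof -
  have "(\<Sum>k\<in>J. f k * (if k = b then 0 else x k)) = (\<Sum>k\<in>J. f k * x k)"
    using assms by (intro sum.cong) auto
  then show ?thesis using assms by simp
qed

text \<open>
  The mechanism behind the recursion. Let \<open>x\<close> and \<open>y\<close> be the unit vectors obtained after deleting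
  the index \<open>b\<close> and the index \<open>a\<close>, respectively. Both are orthogonal to the basis vectors in \<open>J\<close>,
  so they span the orthogonal complement of these in the whole space, and \<open>g\<close> is the inner
  product of \<open>y\<close> with \<open>x\<close>. Together with the basis vectors in \<open>J\<close>, \<open>x\<close> spans the same space as
  all basis vectors except the \<open>b\<close>-th; so removing from \<open>y\<close> its component along \<open>x\<close> leaves a vector
  dual to \<open>b\<close>. By symmetry, \<open>x - cnj g y\<close> is dual to \<open>a\<close>. Both remainders have squared norm \<open>1 - \<bar>g\<bar>\<^sup>2\<close>.
\<close>

lemma dual_unit_recursion:
  fixes H :: "'i \<Rightarrow> 'i \<Rightarrow> complex"
  assumes herm: "hermitian H" and pd: "posdef_on (insert a (insert b J)) H"
    and J: "finite J" "a \<notin> J" "b \<notin> J" "a \<noteq> b"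
    and x: "dual_unit H (insert a J) a x" and y: "dual_unit H (insert b J) b y"
  defines "g \<equiv> x a * (\<Sum>k\<in>insert b J. H a k * y k)"
  defines "d \<equiv> sqrt (1 - (cmod g)\<^sup>2)"
  defines "x' \<equiv> \<lambda>k. if k = b then 0 else x k" and "y' \<equiv> \<lambda>k. if k = a then 0 else y k"
  shows "dual_unit H (insert a (insert b J)) b (\<lambda>k. (y' k - g * x' k) / of_real d)"
    and "dual_unit H (insert a (insert b J)) a (\<lambda>k. (x' k - cnj g * y' k) / of_real d)"
proof -
  let ?I = "insert a (insert b J)"
  obtain s where s: "0 < s" "of_real s * x a = 1"
    "\<And>r. r \<in> insert a J \<Longrightarrow> (\<Sum>k\<in>insert a J. H r k * x k) = (if r = a then of_real s else 0)"
    using x unfolding dual_unit_def by blast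
  obtain t where t: "0 < t" "of_real t * y b = 1"
    "\<And>r. r \<in> insert b J \<Longrightarrow> (\<Sum>k\<in>insert b J. H r k * y k) = (if r = b then of_real t else 0)"
    using y unfolding dual_unit_def by blast
  have xa: "x a = 1 / of_real s" and yb: "y b = 1 / of_real t"
    using s(1,2) t(1,2) by (simp_all add: field_simps)
  have Hx: "(\<Sum>k\<in>?I. H r k * x' k) = (\<Sum>k\<in>insert a J. H r k * x k)" for r
    using sum_delta_out[of "insert a J" b "H r" x] J by (simp add: x'_def insert_commute)
  have Hy: "(\<Sum>k\<in>?I. H r k * y' k) = (\<Sum>k\<in>insert b J. H r k * y k)" for r
    using sum_delta_out[of "insert b J" a "H r" y] J by (simp add: y'_def)
  define p where "p = (\<Sum>k\<in>insert b J. H a k * y k)"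
  define q where "q = (\<Sum>k\<in>insert a J. H b k * x k)"
  have g: "g = p / of_real s"
    by (simp add: g_def p_def xa)
  \<comment> \<open>Pairing \<open>y'\<close> with \<open>x'\<close> in both orders relates the two unknown corner entries \<open>p\<close> and \<open>q\<close>.\<close>
  have "(\<Sum>r\<in>?I. cnj (x' r) * (\<Sum>k\<in>?I. H r k * y' k)) = cnj (\<Sum>r\<in>?I. cnj (y' r) * (\<Sum>k\<in>?I. H r k * x' k))"
  proof -
    have "(\<Sum>r\<in>?I. cnj (x' r) * (\<Sum>k\<in>?I. H r k * y' k)) = (\<Sum>r\<in>?I. \<Sum>k\<in>?I. cnj (x' r) * H r k * y' k)"
      by (simp only: sum_distrib_left mult.assoc)
    also have "\<dots> = (\<Sum>k\<in>?I. \<Sum>r\<in>?I. cnj (x' r) * H r k * y' k)"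
      by (rule sum.swap)
    also have "\<dots> = (\<Sum>k\<in>?I. \<Sum>r\<in>?I. cnj (cnj (y' k) * (H k r * x' r)))"
    proof (intro sum.cong refl)
      fix k r
      have "H r k = cnj (H k r)" using herm unfolding hermitian_def by blast
      then show "cnj (x' r) * H r k * y' k = cnj (cnj (y' k) * (H k r * x' r))"
        by (simp only: complex_cnj_mult complex_cnj_cnj mult_ac)
    qed
    also have "\<dots> = cnj (\<Sum>r\<in>?I. cnj (y' r) * (\<Sum>k\<in>?I. H r k * x' k))"
      by (simp only: cnj_sum sum_distrib_left)
    finally show ?thesis .
  qed
  moreover have "(\<Sum>r\<in>?I. cnj (x' r) * (\<Sum>k\<in>?I. H r k * y' k)) = cnj (x a) * p"
  proof -
    have "(\<Sum>r\<in>insert b J. cnj (x' r) * (\<Sum>k\<in>?I. H r k * y' k)) = 0"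
    proof (intro sum.neutral ballI)
      fix r assume "r \<in> insert b J"
      then show "cnj (x' r) * (\<Sum>k\<in>?I. H r k * y' k) = 0"
        unfolding Hy t(3)[OF \<open>r \<in> insert b J\<close>] by (simp add: x'_def)
    qed
    then show ?thesis
      using J by (subst sum.insert) (simp_all only: Hy p_def, auto simp: x'_def)
  qed
  moreover have "(\<Sum>r\<in>?I. cnj (y' r) * (\<Sum>k\<in>?I. H r k * x' k)) = cnj (y b) * q"
  proof -
    have "(\<Sum>r\<in>insert a J. cnj (y' r) * (\<Sum>k\<in>?I. H r k * x' k)) = 0"
    proof (intro sum.neutral ballI)
      fix r assume "r \<in> insert a J"
      then show "cnj (y' r) * (\<Sum>k\<in>?I. H r k * x' k) = 0"
        unfolding Hx s(3)[OF \<open>r \<in> insert a J\<close>] by (simp add: y'_def)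
    qed
    then have "(\<Sum>r\<in>insert b (insert a J). cnj (y' r) * (\<Sum>k\<in>?I. H r k * x' k)) = cnj (y b) * q"
      using J by (subst sum.insert) (simp_all only: Hx q_def, auto simp: y'_def)
    then show ?thesis by (simp only: insert_commute)
  qed
  ultimately have "p / of_real s = cnj (q / of_real t)"
    by (simp add: xa yb)
  then have "cnj g = q / of_real t"
    unfolding g by simp
  then have q: "q = of_real t * cnj g" and p: "p = of_real s * g"
    using s(1) t(1) by (simp_all add: g)
  have Ky: "(\<Sum>k\<in>?I. H r k * y' k) = (if r = a then of_real s * g else if r = b then of_real t else 0)"
    if "r \<in> ?I" for r
  proof (cases "r = a")
    case True
    then show ?thesis by (simp only: Hy p_def[symmetric] p) simp
  next
    case False
    then show ?thesis using that t(3)[of r] by (simp only: Hy) auto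
  qed
  have Kx: "(\<Sum>k\<in>?I. H r k * x' k) = (if r = a then of_real s else if r = b then of_real t * cnj g else 0)"
    if "r \<in> ?I" for r
  proof (cases "r = b")
    case True
    then show ?thesis using J by (simp only: Hx q_def[symmetric] q) simp
  next
    case False
    then show ?thesis using that s(3)[of r] by (simp only: Hx) auto
  qed
  have gg: "g * cnj g = of_real ((cmod g)\<^sup>2)" "cnj g * g = of_real ((cmod g)\<^sup>2)"
    by (simp_all only: complex_norm_square mult.commute[of "cnj g"])
  have Kd: "(\<Sum>k\<in>?I. H r k * (y' k - g * x' k)) = (if r = b then of_real (t * (1 - (cmod g)\<^sup>2)) else 0)"
    if "r \<in> ?I" for r
  proof -
    have "(\<Sum>k\<in>?I. H r k * (y' k - g * x' k)) = (\<Sum>k\<in>?I. H r k * y' k) - g * (\<Sum>k\<in>?I. H r k * x' k)"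
      by (simp only: right_diff_distrib sum_subtractf sum_distrib_left) (simp only: mult.left_commute)
    also have "\<dots> = (if r = b then of_real t - of_real t * (g * cnj g) else 0)"
      unfolding Kx[OF that] Ky[OF that] using J by simp
    finally show ?thesis unfolding gg by (simp add: algebra_simps)
  qed
  have Kd': "(\<Sum>k\<in>?I. H r k * (x' k - cnj g * y' k)) = (if r = a then of_real (s * (1 - (cmod g)\<^sup>2)) else 0)"
    if "r \<in> ?I" for r
  proof -
    have "(\<Sum>k\<in>?I. H r k * (x' k - cnj g * y' k)) = (\<Sum>k\<in>?I. H r k * x' k) - cnj g * (\<Sum>k\<in>?I. H r k * y' k)"
      by (simp only: right_diff_distrib sum_subtractf sum_distrib_left) (simp only: mult.left_commute)
    also have "\<dots> = (if r = a then of_real s - of_real s * (cnj g * g) else 0)"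
      unfolding Kx[OF that] Ky[OF that] using J by simp
    finally show ?thesis unfolding gg by (simp add: algebra_simps)
  qed
  \<comment> \<open>The squared norm of \<open>y' - g x'\<close> is \<open>1 - \<bar>g\<bar>\<^sup>2\<close>; the vector is nonzero at \<open>b\<close>.\<close>
  have lt1: "0 < 1 - (cmod g)\<^sup>2"
  proof -
    define w where "w = (\<lambda>k. y' k - g * x' k)"
    have wb: "w b = 1 / of_real t"
      using J by (simp add: w_def x'_def y'_def yb)
    then have "\<exists>i\<in>?I. w i \<noteq> 0" using t(1) by auto
    then have "0 < (\<Sum>r\<in>?I. \<Sum>k\<in>?I. cnj (w r) * H r k * w k)"
      using pd unfolding posdef_on_def by blast
    also have "\<dots> = (\<Sum>r\<in>?I. cnj (w r) * (\<Sum>k\<in>?I. H r k * w k))"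
      by (rule form_rows)
    also have "\<dots> = (\<Sum>r\<in>?I. if r = b then cnj (w b) * of_real (t * (1 - (cmod g)\<^sup>2)) else 0)"
      using Kd by (intro sum.cong refl) (simp only: w_def, auto)
    also have "\<dots> = cnj (w b) * of_real (t * (1 - (cmod g)\<^sup>2))"
      using J(1) by (subst sum.delta) auto
    also have "\<dots> = of_real (1 - (cmod g)\<^sup>2)"
      using t(1) by (simp add: wb)
    finally show ?thesis by (simp add: less_complex_def)
  qed
  then have d: "0 < d" by (simp add: d_def)
  have dd: "1 - (cmod g)\<^sup>2 = d * d"
    using lt1 by (simp add: d_def)
  have "(\<Sum>k\<in>?I. H r k * ((y' k - g * x' k) / of_real d)) = (if r = b then of_real (t * d) else 0)"
    if "r \<in> ?I" for r
    using Kd[OF that] d by (simp only: times_divide_eq_right sum_divide_distrib[symmetric]) (simp add: dd)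
  moreover have "of_real (t * d) * ((y' b - g * x' b) / of_real d) = (1::complex)"
    using J d t(1) by (simp add: x'_def y'_def yb)
  ultimately show "dual_unit H ?I b (\<lambda>k. (y' k - g * x' k) / of_real d)"
    unfolding dual_unit_def using d t(1) by (intro exI[of _ "t * d"]) auto
  have "(\<Sum>k\<in>?I. H r k * ((x' k - cnj g * y' k) / of_real d)) = (if r = a then of_real (s * d) else 0)"
    if "r \<in> ?I" for r
    using Kd'[OF that] d by (simp only: times_divide_eq_right sum_divide_distrib[symmetric]) (simp add: dd)
  moreover have "of_real (s * d) * ((x' a - cnj g * y' a) / of_real d) = (1::complex)"
    using J d s(1) by (simp add: x'_def y'_def xa)
  ultimately show "dual_unit H ?I a (\<lambda>k. (x' k - cnj g * y' k) / of_real d)"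
    unfolding dual_unit_def using d s(1) by (intro exI[of _ "s * d"]) auto
qed

text \<open>
  The blocks of a kernel become matrices with indices starting at \<open>0\<close>, possibly in reversed order;
  positivity goes from the block to the matrix, and dual vectors go back.
\<close>

lemma posdef_on_image:
  assumes inv: "\<And>i. i \<in> I \<Longrightarrow> g (f i) = i" and pd: "posdef_on (f ` I) H"
  shows "posdef_on I (\<lambda>r k. H (f r) (f k))"
  unfolding posdef_on_def
proof (intro allI impI)
  fix x :: "'a \<Rightarrow> complex" assume x: "\<exists>i\<in>I. x i \<noteq> 0"
  have inj: "inj_on f I" using inv by (rule inj_on_inverseI)
  have "\<exists>j\<in>f ` I. x (g j) \<noteq> 0"
    using x by (auto simp: inv)
  then have "0 < (\<Sum>r\<in>f ` I. \<Sum>k\<in>f ` I. cnj (x (g r)) * H r k * x (g k))"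
    using pd[unfolded posdef_on_def, rule_format, of "\<lambda>k. x (g k)"] by blast
  also have "\<dots> = (\<Sum>r\<in>I. \<Sum>k\<in>I. cnj (x r) * H (f r) (f k) * x k)"
    by (simp add: sum.reindex[OF inj] inv)
  finally show "0 < (\<Sum>r\<in>I. \<Sum>k\<in>I. cnj (x r) * H (f r) (f k) * x k)" .
qed

lemma dual_unit_image:
  assumes inv: "\<And>i. i \<in> I \<Longrightarrow> g (f i) = i" and l: "l \<in> I"
    and x: "dual_unit (\<lambda>r k. H (f r) (f k)) I l x"
  shows "dual_unit H (f ` I) (f l) (\<lambda>k. x (g k))"
proof -
  have inj: "inj_on f I" using inv by (rule inj_on_inverseI)
  have "f r = f l \<longleftrightarrow> r = l" if "r \<in> I" for r
    using inj that l by (auto dest: inj_onD)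
  then show ?thesis
    using x unfolding dual_unit_def by (simp add: sum.reindex[OF inj] inv l)
qed

section \<open>Triangular factors of positive definite matrices\<close>

lemma posdef_on_diag:
  assumes "posdef_on I H" "finite I" "i \<in> I"
  shows "0 < H i i"
proof -
  define x where "x = (\<lambda>k. if k = i then 1 else 0 :: complex)"
  have "0 < (\<Sum>r\<in>I. cnj (x r) * (\<Sum>k\<in>I. H r k * x k))"
    using assms(1,3) unfolding posdef_on_def form_rows[symmetric]
    by (auto simp: x_def)
  also have "\<dots> = H i i"
    using assms(2,3) by (simp add: x_def if_distrib if_distribR cong: if_cong)
  finally show ?thesis .
qed

text \<open>
  Triangular factorizations are built and compared by peeling off the first row and column, which
  reduces the size by passing to the Schur complement of the corner entry.
\<close>

definition cholesky_factor :: "nat \<Rightarrow> (nat \<Rightarrow> nat \<Rightarrow> complex) \<Rightarrow> (nat \<Rightarrow> nat \<Rightarrow> complex) \<Rightarrow> bool" where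
  "cholesky_factor n K F \<longleftrightarrow> (\<forall>i<n. \<forall>j<i. F i j = 0) \<and> (\<forall>i<n. 0 < F i i) \<and>
     (\<forall>i<n. \<forall>j<n. K i j = (\<Sum>k<n. cnj (F k i) * F k j))"

lemma posdef_schur_complement:
  assumes herm: "hermitian K" and pd: "posdef_on {..<Suc n} K"
  defines "B \<equiv> \<lambda>i j. K (Suc i) (Suc j) - K (Suc i) 0 * K 0 (Suc j) / K 0 0"
  shows "hermitian B" and "posdef_on {..<n} B"
proof -
  have K00: "K 0 0 \<noteq> 0"
    using posdef_on_diag[OF pd, of 0] by auto
  have herm': "cnj (K i j) = K j i" for i j
    using herm unfolding hermitian_def by metis
  show "hermitian B"
    unfolding hermitian_def B_def by (simp add: herm' mult.commute)
  show "posdef_on {..<n} B"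
    unfolding posdef_on_def
  proof (intro allI impI)
    fix x :: "nat \<Rightarrow> complex" assume x: "\<exists>i\<in>{..<n}. x i \<noteq> 0"
    \<comment> \<open>The zeroth coordinate is chosen so that the zeroth row annihilates the vector.\<close>
    define y where "y = (\<lambda>k. case k of 0 \<Rightarrow> - (\<Sum>k<n. K 0 (Suc k) * x k) / K 0 0 | Suc k \<Rightarrow> x k)"
    have "\<exists>i\<in>{..<Suc n}. y i \<noteq> 0"
      using x by (auto simp: y_def intro!: bexI[of _ "Suc _"])
    then have "0 < (\<Sum>r<Suc n. cnj (y r) * (\<Sum>k<Suc n. K r k * y k))"
      using pd unfolding posdef_on_def form_rows by blast
    also have "\<dots> = (\<Sum>r<n. cnj (x r) * (\<Sum>k<n. B r k * x k))"
    proof -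
      have row0: "(\<Sum>k<Suc n. K 0 k * y k) = 0"
        unfolding sum.lessThan_Suc_shift using K00 by (simp add: y_def)
      have row: "(\<Sum>k<Suc n. K (Suc r) k * y k) = (\<Sum>k<n. B r k * x k)" for r
        unfolding sum.lessThan_Suc_shift B_def
        by (simp add: y_def left_diff_distrib sum_subtractf sum_distrib_left sum_divide_distrib
            mult.assoc)
      show ?thesis
        unfolding sum.lessThan_Suc_shift[of "\<lambda>r. cnj (y r) * (\<Sum>k<Suc n. K r k * y k)"] row0 row
        by (simp add: y_def)
    qed
    finally show "0 < (\<Sum>r<n. \<Sum>k<n. cnj (x r) * B r k * x k)"
      unfolding form_rows .
  qed
qed

lemma cholesky_factor_exists:
  assumes "hermitian K" "posdef_on {..<n} K"
  shows "\<exists>F. cholesky_factor n K F"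
  using assms
proof (induction n arbitrary: K)
  case 0
  show ?case by (simp add: cholesky_factor_def)
next
  case (Suc n)
  define B where "B = (\<lambda>i j. K (Suc i) (Suc j) - K (Suc i) 0 * K 0 (Suc j) / K 0 0)"
  obtain F where F: "cholesky_factor n B F"
    using Suc.IH posdef_schur_complement[OF Suc.prems] unfolding B_def by blast
  obtain a where a: "0 < a" "K 0 0 = of_real a"
    using posdef_on_diag[OF Suc.prems(2), of 0] by (auto simp: pos_complex_iff)
  have herm': "cnj (K i j) = K j i" for i j
    using Suc.prems(1) unfolding hermitian_def by metis
  have sq: "complex_of_real (sqrt a) * complex_of_real (sqrt a) = of_real a"
    using a(1) by (simp flip: of_real_mult)
  define G where "G = (\<lambda>i j. case i of 0 \<Rightarrow> K 0 j / of_real (sqrt a)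
    | Suc i \<Rightarrow> (case j of 0 \<Rightarrow> 0 | Suc j \<Rightarrow> F i j))"
  have "cholesky_factor (Suc n) K G"
    unfolding cholesky_factor_def
  proof (intro conjI allI impI)
    fix i j assume "i < Suc n" "j < i"
    then show "G i j = 0"
      using F by (auto simp: G_def cholesky_factor_def split: nat.split)
  next
    fix i assume "i < Suc n"
    have "K 0 0 / of_real (sqrt a) = of_real (sqrt a)"
      unfolding a(2) sq[symmetric] using a(1) by simp
    then show "0 < G i i"
      using F \<open>i < Suc n\<close> a(1)
      by (cases i) (auto simp: G_def cholesky_factor_def less_complex_def)
  next
    fix i j assume ij: "i < Suc n" "j < Suc n"
    have "(\<Sum>k<Suc n. cnj (G k i) * G k j) = K i 0 * K 0 j / of_real a + (\<Sum>k<n. cnj (G (Suc k) i) * G (Suc k) j)"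
      unfolding sum.lessThan_Suc_shift by (simp add: G_def herm' sq)
    also have "\<dots> = K i j"
    proof (cases "i = 0 \<or> j = 0")
      case True
      then show ?thesis using a by (auto simp: G_def)
    next
      case False
      then obtain i' j' where i': "i = Suc i'" and j': "j = Suc j'"
        using not0_implies_Suc by blast
      then have "(\<Sum>k<n. cnj (F k i') * F k j') = B i' j'"
        using ij F by (simp add: cholesky_factor_def)
      then show ?thesis
        by (simp add: i' j' G_def B_def a(2))
    qed
    finally show "K i j = (\<Sum>k<Suc n. cnj (G k i) * G k j)" by simp
  qed
  then show ?case by (rule exI[of _ G])
qed

lemma cholesky_factor_unique:
  assumes "cholesky_factor n K F" "cholesky_factor n K G" "i < n" "j < n"
  shows "F i j = G i j"
  using assms
proof (induction n arbitrary: K F G i j)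
  case 0
  then show ?case by simp
next
  case (Suc n)
  have first: "K 0 j = cnj (M 0 0) * M 0 j" if M: "cholesky_factor (Suc n) K M" and "j < Suc n" for M j
  proof -
    have "K 0 j = (\<Sum>k<Suc n. cnj (M k 0) * M k j)"
      using M \<open>j < Suc n\<close> unfolding cholesky_factor_def by blast
    moreover have "(\<Sum>k<n. cnj (M (Suc k) 0) * M (Suc k) j) = 0"
      using M unfolding cholesky_factor_def by (intro sum.neutral) auto
    ultimately show ?thesis
      unfolding sum.lessThan_Suc_shift by simp
  qed
  have "0 < F 0 0" "0 < G 0 0"
    using Suc.prems(1,2) by (simp_all add: cholesky_factor_def)
  then obtain f g where f: "0 < f" "F 0 0 = of_real f" and g: "0 < g" "G 0 0 = of_real g"
    unfolding pos_complex_iff by auto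
  have "complex_of_real (f * f) = of_real (g * g)"
    using first[OF Suc.prems(1), of 0] first[OF Suc.prems(2), of 0] f(2) g(2) by simp
  then have "f\<^sup>2 = g\<^sup>2"
    by (simp only: of_real_eq_iff power2_eq_square)
  then have fg: "f = g"
    using f(1) g(1) by (simp add: power2_eq_iff_nonneg)
  have row0: "F 0 j = G 0 j" if "j < Suc n" for j
  proof -
    have "of_real f * F 0 j = of_real g * G 0 j"
      using first[OF Suc.prems(1) that] first[OF Suc.prems(2) that] f(2) g(2) by simp
    then show ?thesis using fg g(1) by simp
  qed
  define K' where "K' = (\<lambda>i j. K (Suc i) (Suc j) - cnj (F 0 (Suc i)) * F 0 (Suc j))"
  have shift: "cholesky_factor n K' (\<lambda>i j. M (Suc i) (Suc j))"
    if M: "cholesky_factor (Suc n) K M" and eq: "\<And>j. j < Suc n \<Longrightarrow> M 0 j = F 0 j" for M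
    unfolding cholesky_factor_def
  proof (intro conjI allI impI)
    fix i j assume ij: "i < n" "j < n"
    then have "K (Suc i) (Suc j) = (\<Sum>k<Suc n. cnj (M k (Suc i)) * M k (Suc j))"
      using M unfolding cholesky_factor_def by auto
    then show "K' i j = (\<Sum>k<n. cnj (M (Suc k) (Suc i)) * M (Suc k) (Suc j))"
      unfolding K'_def sum.lessThan_Suc_shift using ij by (simp add: eq)
  qed (use M in \<open>auto simp: cholesky_factor_def\<close>)
  have rest: "F (Suc i) (Suc j) = G (Suc i) (Suc j)" if "i < n" "j < n" for i j
    by (rule Suc.IH[OF shift[OF Suc.prems(1) refl] shift[OF Suc.prems(2) row0[symmetric]] that])
  show ?case
  proof (cases i)
    case 0
    then show ?thesis using row0 Suc.prems(4) by simp
  next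
    case (Suc i')
    show ?thesis
    proof (cases j)
      case 0
      then show ?thesis using Suc Suc.prems by (auto simp: cholesky_factor_def)
    next
      case (Suc j')
      then show ?thesis using \<open>i = Suc i'\<close> rest Suc.prems(3,4) by simp
    qed
  qed
qed

lemma mat_adjoint_carrier: "F \<in> carrier_mat n n \<Longrightarrow> mat_adjoint F \<in> carrier_mat n n"
  by (intro carrier_matI) (simp_all add: mat_adjoint_def)

lemma mat_adjoint_index:
  assumes "F \<in> carrier_mat n n" "i < n" "j < n"
  shows "mat_adjoint F $$ (i, j) = cnj (F $$ (j, i))"
  using assms by (simp add: mat_adjoint_def mat_of_rows_index)

lemma gram_index:
  assumes F: "F \<in> carrier_mat n n" and ij: "i < n" "j < n"
  shows "(mat_adjoint F * F) $$ (i, j) = (\<Sum>k<n. cnj (F $$ (k, i)) * F $$ (k, j))"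
proof -
  have "(mat_adjoint F * F) $$ (i, j) = (\<Sum>k\<in>{0..<n}. mat_adjoint F $$ (i, k) * F $$ (k, j))"
    using mat_adjoint_carrier[OF F] F ij by (simp add: scalar_prod_def)
  then show ?thesis
    using F ij by (simp add: mat_adjoint_index[OF F] atLeast0LessThan)
qed

lemma eq_gram_iff:
  assumes F: "F \<in> carrier_mat n n"
  shows "Matrix.mat n n (\<lambda>(i, j). K i j) = mat_adjoint F * F \<longleftrightarrow>
    (\<forall>i<n. \<forall>j<n. K i j = (\<Sum>k<n. cnj (F $$ (k, i)) * F $$ (k, j)))"
proof -
  have c: "mat_adjoint F * F \<in> carrier_mat n n"
    by (rule mult_carrier_mat[OF mat_adjoint_carrier[OF F] F])
  show ?thesis
  proof
    assume eq: "Matrix.mat n n (\<lambda>(i, j). K i j) = mat_adjoint F * F"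
    show "\<forall>i<n. \<forall>j<n. K i j = (\<Sum>k<n. cnj (F $$ (k, i)) * F $$ (k, j))"
    proof (intro allI impI)
      fix i j assume ij: "i < n" "j < n"
      then have "K i j = Matrix.mat n n (\<lambda>(i, j). K i j) $$ (i, j)" by simp
      then show "K i j = (\<Sum>k<n. cnj (F $$ (k, i)) * F $$ (k, j))"
        unfolding eq gram_index[OF F ij] .
    qed
  next
    assume eq: "\<forall>i<n. \<forall>j<n. K i j = (\<Sum>k<n. cnj (F $$ (k, i)) * F $$ (k, j))"
    show "Matrix.mat n n (\<lambda>(i, j). K i j) = mat_adjoint F * F"
    proof (rule eq_matI)
      fix i j assume "i < dim_row (mat_adjoint F * F)" "j < dim_col (mat_adjoint F * F)"
      then have ij: "i < n" "j < n"
        unfolding carrier_matD[OF c] .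
      then have "Matrix.mat n n (\<lambda>(i, j). K i j) $$ (i, j) = K i j" by simp
      also have "\<dots> = (mat_adjoint F * F) $$ (i, j)"
        unfolding gram_index[OF F ij] using eq ij by blast
      finally show "Matrix.mat n n (\<lambda>(i, j). K i j) $$ (i, j) = (mat_adjoint F * F) $$ (i, j)" .
    qed (simp_all only: carrier_matD[OF c] dim_row_mat dim_col_mat)
  qed
qed

lemma upper_factor:
  assumes "hermitian K" "posdef_on {..<n} K"
  defines "A \<equiv> Matrix.mat n n (\<lambda>(i, j). K i j)"
  shows "upper_factor A \<in> carrier_mat n n \<and> upper_triangular (upper_factor A) \<and>
    (\<forall>k<n. 0 < upper_factor A $$ (k, k)) \<and> A = mat_adjoint (upper_factor A) * upper_factor A"
proof -
  have dim: "dim_row A = n" by (simp add: A_def)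
  have iff: "upper_triangular F \<and> (\<forall>k<n. 0 < F $$ (k, k)) \<and> A = mat_adjoint F * F \<longleftrightarrow>
      cholesky_factor n K (\<lambda>i j. F $$ (i, j))" if "F \<in> carrier_mat n n" for F
    unfolding A_def eq_gram_iff[OF that] cholesky_factor_def using that by auto
  obtain F where F: "cholesky_factor n K F"
    using cholesky_factor_exists assms by blast
  have "\<exists>!F. F \<in> carrier_mat n n \<and> upper_triangular F \<and> (\<forall>k<n. 0 < F $$ (k, k)) \<and> A = mat_adjoint F * F"
  proof (rule ex_ex1I)
    define M where "M = Matrix.mat n n (\<lambda>(i, j). F i j)"
    have "cholesky_factor n K (\<lambda>i j. M $$ (i, j))"
      using F unfolding cholesky_factor_def M_def by auto
    moreover have "M \<in> carrier_mat n n" by (simp add: M_def)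
    ultimately show "\<exists>F. F \<in> carrier_mat n n \<and> upper_triangular F \<and> (\<forall>k<n. 0 < F $$ (k, k)) \<and> A = mat_adjoint F * F"
      using iff by blast
  next
    fix F G
    assume "F \<in> carrier_mat n n \<and> upper_triangular F \<and> (\<forall>k<n. 0 < F $$ (k, k)) \<and> A = mat_adjoint F * F"
      and "G \<in> carrier_mat n n \<and> upper_triangular G \<and> (\<forall>k<n. 0 < G $$ (k, k)) \<and> A = mat_adjoint G * G"
    then have FG: "F \<in> carrier_mat n n" "G \<in> carrier_mat n n"
      "cholesky_factor n K (\<lambda>i j. F $$ (i, j))" "cholesky_factor n K (\<lambda>i j. G $$ (i, j))"
      using iff by blast+
    show "F = G"
      by (rule eq_matI) (use FG(1,2) cholesky_factor_unique[OF FG(3,4)] in auto)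
  qed
  then show ?thesis
    unfolding upper_factor_def dim by (rule theI')
qed

text \<open>
  Reversing the order of the basis exchanges lower and upper triangular factors.
\<close>

lemma lower_factor:
  assumes herm: "hermitian K" and pd: "posdef_on {..<n} (\<lambda>i j. K (n - 1 - i) (n - 1 - j))"
  defines "A \<equiv> Matrix.mat n n (\<lambda>(i, j). K i j)"
  shows "lower_factor A \<in> carrier_mat n n \<and> upper_triangular (transpose_mat (lower_factor A)) \<and>
    (\<forall>k<n. 0 < lower_factor A $$ (k, k)) \<and> A = mat_adjoint (lower_factor A) * lower_factor A"
proof -
  have dim: "dim_row A = n" by (simp add: A_def)
  define R where "R = (\<lambda>i j. K (n - 1 - i) (n - 1 - j))"
  have hR: "hermitian R"
    using herm unfolding hermitian_def R_def by blast
  have rev: "n - 1 - i < n" "n - 1 - (n - 1 - i) = i" if "i < n" for i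
    using that by auto
  have rev_all: "(\<forall>i<n. P (n - 1 - i)) \<longleftrightarrow> (\<forall>i<n. P i)" for P
    using rev by metis
  have rev_sum: "(\<Sum>k<n. f (n - 1 - k)) = (\<Sum>k<n. f k)" for f :: "nat \<Rightarrow> complex"
    using sum.nat_diff_reindex[of f n] by simp
  have iff: "upper_triangular (transpose_mat F) \<and> (\<forall>k<n. 0 < F $$ (k, k)) \<and> A = mat_adjoint F * F \<longleftrightarrow>
      cholesky_factor n R (\<lambda>i j. F $$ (n - 1 - i, n - 1 - j))" if F: "F \<in> carrier_mat n n" for F
  proof -
    have "upper_triangular (transpose_mat F) \<longleftrightarrow> (\<forall>i<n. \<forall>j<i. F $$ (j, i) = 0)"
      using F by (auto simp: upper_triangular_def)
    also have "\<dots> \<longleftrightarrow> (\<forall>i<n. \<forall>j<i. F $$ (n - 1 - i, n - 1 - j) = 0)" (is "?L \<longleftrightarrow> ?R")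
    proof (intro iffI allI impI)
      fix i j assume L: ?L and "i < n" "j < i"
      then show "F $$ (n - 1 - i, n - 1 - j) = 0"
        using L[rule_format, of "n - 1 - j" "n - 1 - i"] by simp
    next
      fix i j assume R: ?R and "i < n" "j < i"
      then show "F $$ (j, i) = 0"
        using R[rule_format, of "n - 1 - j" "n - 1 - i"] by simp
    qed
    finally have tri: "upper_triangular (transpose_mat F) \<longleftrightarrow> (\<forall>i<n. \<forall>j<i. F $$ (n - 1 - i, n - 1 - j) = 0)" .
    have diag: "(\<forall>k<n. 0 < F $$ (k, k)) \<longleftrightarrow> (\<forall>k<n. 0 < F $$ (n - 1 - k, n - 1 - k))"
      using rev_all[of "\<lambda>k. 0 < F $$ (k, k)"] by simp
    have "(\<forall>i<n. \<forall>j<n. K i j = (\<Sum>k<n. cnj (F $$ (k, i)) * F $$ (k, j))) \<longleftrightarrow>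
      (\<forall>i<n. \<forall>j<n. R i j = (\<Sum>k<n. cnj (F $$ (k, n - 1 - i)) * F $$ (k, n - 1 - j)))"
      unfolding R_def
      using rev_all[of "\<lambda>i. \<forall>j<n. K i j = (\<Sum>k<n. cnj (F $$ (k, i)) * F $$ (k, j))"]
        rev_all[of "\<lambda>j. K _ j = (\<Sum>k<n. cnj (F $$ (k, _)) * F $$ (k, j))"] by simp
    also have "\<dots> \<longleftrightarrow> (\<forall>i<n. \<forall>j<n. R i j =
        (\<Sum>k<n. cnj (F $$ (n - 1 - k, n - 1 - i)) * F $$ (n - 1 - k, n - 1 - j)))"
      using rev_sum[of "\<lambda>k. cnj (F $$ (k, n - 1 - _)) * F $$ (k, n - 1 - _)"] by simp
    finally show ?thesis
      unfolding A_def eq_gram_iff[OF F] tri diag cholesky_factor_def by simp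
  qed
  obtain F where F: "cholesky_factor n R F"
    using cholesky_factor_exists[OF hR pd[folded R_def]] by blast
  have "\<exists>!F. F \<in> carrier_mat n n \<and> upper_triangular (transpose_mat F) \<and> (\<forall>k<n. 0 < F $$ (k, k))
      \<and> A = mat_adjoint F * F"
  proof (rule ex_ex1I)
    define M where "M = Matrix.mat n n (\<lambda>(i, j). F (n - 1 - i) (n - 1 - j))"
    have "M $$ (n - 1 - i, n - 1 - j) = F i j" if "i < n" "j < n" for i j
      using that by (simp add: M_def)
    then have "cholesky_factor n R (\<lambda>i j. M $$ (n - 1 - i, n - 1 - j))"
      using F unfolding cholesky_factor_def by auto
    moreover have "M \<in> carrier_mat n n" by (simp add: M_def)
    ultimately show "\<exists>F. F \<in> carrier_mat n n \<and> upper_triangular (transpose_mat F) \<and>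
        (\<forall>k<n. 0 < F $$ (k, k)) \<and> A = mat_adjoint F * F"
      using iff by blast
  next
    fix F G
    assume "F \<in> carrier_mat n n \<and> upper_triangular (transpose_mat F) \<and> (\<forall>k<n. 0 < F $$ (k, k)) \<and> A = mat_adjoint F * F"
      and "G \<in> carrier_mat n n \<and> upper_triangular (transpose_mat G) \<and> (\<forall>k<n. 0 < G $$ (k, k)) \<and> A = mat_adjoint G * G"
    then have FG: "F \<in> carrier_mat n n" "G \<in> carrier_mat n n"
      "cholesky_factor n R (\<lambda>i j. F $$ (n - 1 - i, n - 1 - j))"
      "cholesky_factor n R (\<lambda>i j. G $$ (n - 1 - i, n - 1 - j))"
      using iff by blast+
    have "F $$ (i, j) = G $$ (i, j)" if "i < n" "j < n" for i j
      using cholesky_factor_unique[OF FG(3,4) rev(1)[OF that(1)] rev(1)[OF that(2)]]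
      by (simp only: rev(2) that)
    then show "F = G"
      by (intro eq_matI) (use FG(1,2) in auto)
  qed
  then show ?thesis
    unfolding lower_factor_def dim by (rule theI')
qed

lemma mat_inverse_det:
  fixes A :: "complex mat"
  assumes A: "A \<in> carrier_mat n n" and det: "det A \<noteq> 0"
  shows "the (mat_inverse A) \<in> carrier_mat n n"
    and "A * the (mat_inverse A) = 1\<^sub>m n" and "the (mat_inverse A) * A = 1\<^sub>m n"
proof -
  obtain B where "mat_inverse A = Some B"
    using mat_inverse(1)[OF A, of "()"] det_non_zero_imp_unit[OF A det, of "()"]
    by (cases "mat_inverse A") auto
  then show "the (mat_inverse A) \<in> carrier_mat n n"
    and "A * the (mat_inverse A) = 1\<^sub>m n" and "the (mat_inverse A) * A = 1\<^sub>m n"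
    using mat_inverse(2)[OF A, of B] by auto
qed

lemma det_upper_triangular_pos:
  fixes F :: "complex mat"
  assumes "F \<in> carrier_mat n n" "upper_triangular F" "\<And>k. k < n \<Longrightarrow> 0 < F $$ (k, k)"
  shows "det F \<noteq> 0"
proof -
  have "F $$ (k, k) \<noteq> 0" if "k < n" for k
    using assms(3)[OF that] by auto
  then have "0 \<notin> set (diag_mat F)"
    using assms(1) by (auto simp: diag_mat_def)
  then show ?thesis
    by (simp add: upper_triangular_imp_det_eq_0_iff[OF assms(1,2)])
qed

text \<open>
  If \<open>K = F\<^sup>* F\<close>, then \<open>K\<close> maps the \<open>l\<close>-th column of \<open>F\<^sup>-\<^sup>1\<close> to \<open>F\<^sup>* e\<^sub>l\<close>, the conjugate of
  the \<open>l\<close>-th row of \<open>F\<close>. For the last row of an upper triangular or the first row of a lower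
  triangular factor only the diagonal entry survives.
\<close>

lemma dual_unit_inverse_column:
  assumes F: "F \<in> carrier_mat n n" "det F \<noteq> 0"
    and gram: "\<And>i j. i < n \<Longrightarrow> j < n \<Longrightarrow> K i j = (\<Sum>k<n. cnj (F $$ (k, i)) * F $$ (k, j))"
    and l: "l < n" "0 < F $$ (l, l)" "\<And>j. j < n \<Longrightarrow> j \<noteq> l \<Longrightarrow> F $$ (l, j) = 0"
  shows "dual_unit K {..<n} l (vec_index (col (the (mat_inverse F)) l))"
proof -
  define X where "X = the (mat_inverse F)"
  have X: "X \<in> carrier_mat n n" "F * X = 1\<^sub>m n"
    using mat_inverse_det[OF F] by (simp_all add: X_def)
  obtain c where c: "0 < c" "F $$ (l, l) = of_real c"
    using l(2) by (auto simp: pos_complex_iff)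
  have FX: "(\<Sum>k<n. F $$ (m, k) * X $$ (k, l)) = (if m = l then 1 else 0)" if "m < n" for m
  proof -
    have "(F * X) $$ (m, l) = (\<Sum>k<n. F $$ (m, k) * X $$ (k, l))"
      using F(1) X(1) l(1) that by (simp add: scalar_prod_def atLeast0LessThan)
    then show ?thesis using X(2) l(1) that by simp
  qed
  have x: "vec_index (col X l) k = X $$ (k, l)" if "k < n" for k
    using X l(1) that by simp
  have "(\<Sum>k<n. K r k * vec_index (col X l) k) = (if r = l then of_real c else 0)" if r: "r < n" for r
  proof -
    have "(\<Sum>k<n. K r k * vec_index (col X l) k) = (\<Sum>k<n. \<Sum>m<n. cnj (F $$ (m, r)) * (F $$ (m, k) * X $$ (k, l)))"
      using r by (intro sum.cong refl) (simp add: x gram sum_distrib_right mult.assoc)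
    also have "\<dots> = (\<Sum>m<n. cnj (F $$ (m, r)) * (\<Sum>k<n. F $$ (m, k) * X $$ (k, l)))"
      by (subst sum.swap) (simp only: sum_distrib_left)
    also have "\<dots> = (\<Sum>m<n. if m = l then cnj (F $$ (l, r)) else 0)"
      by (intro sum.cong refl) (simp add: FX)
    also have "\<dots> = cnj (F $$ (l, r))"
      using l(1) by simp
    finally show ?thesis using r l(3)[of r] c(2) by auto
  qed
  moreover have "of_real c * vec_index (col X l) l = 1"
  proof -
    have "(\<Sum>k<n. F $$ (l, k) * X $$ (k, l)) = (\<Sum>k<n. if k = l then of_real c * X $$ (l, l) else 0)"
      by (intro sum.cong refl) (auto simp: l(3) c(2))
    then show ?thesis using FX[OF l(1)] l(1) by (simp add: x)
  qed
  ultimately show ?thesis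
    unfolding dual_unit_def X_def[symmetric] using c(1) by (intro exI[of _ c]) auto
qed

lemma upper_factor_dual_unit:
  assumes K: "hermitian K" "posdef_on {..<Suc m} K"
  shows "dual_unit K {..<Suc m} m
    (vec_index (col (the (mat_inverse (upper_factor (Matrix.mat (Suc m) (Suc m) (\<lambda>(i, j). K i j))))) m))"
proof -
  define F where "F = upper_factor (Matrix.mat (Suc m) (Suc m) (\<lambda>(i, j). K i j))"
  have F: "F \<in> carrier_mat (Suc m) (Suc m)" "upper_triangular F" "\<And>k. k < Suc m \<Longrightarrow> 0 < F $$ (k, k)"
    "Matrix.mat (Suc m) (Suc m) (\<lambda>(i, j). K i j) = mat_adjoint F * F"
    using upper_factor[OF K] unfolding F_def by blast+
  show ?thesis
    unfolding F_def[symmetric]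
  proof (rule dual_unit_inverse_column[OF F(1)])
    show "det F \<noteq> 0" by (rule det_upper_triangular_pos[OF F(1-3)])
    show "F $$ (m, j) = 0" if "j < Suc m" "j \<noteq> m" for j
      using that F(1) by (intro upper_triangularD[OF F(2)]) auto
  qed (use F(3) F(4)[unfolded eq_gram_iff[OF F(1)]] in auto)
qed

lemma lower_factor_dual_unit:
  assumes K: "hermitian K" "posdef_on {..<Suc m} (\<lambda>i j. K (m - i) (m - j))"
  shows "dual_unit K {..<Suc m} 0
    (vec_index (col (the (mat_inverse (lower_factor (Matrix.mat (Suc m) (Suc m) (\<lambda>(i, j). K i j))))) 0))"
proof -
  define F where "F = lower_factor (Matrix.mat (Suc m) (Suc m) (\<lambda>(i, j). K i j))"
  have F: "F \<in> carrier_mat (Suc m) (Suc m)" "upper_triangular (transpose_mat F)"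
    "\<And>k. k < Suc m \<Longrightarrow> 0 < F $$ (k, k)"
    "Matrix.mat (Suc m) (Suc m) (\<lambda>(i, j). K i j) = mat_adjoint F * F"
    using lower_factor[OF K(1), of "Suc m"] K(2) unfolding F_def by simp_all
  have Ft: "transpose_mat F \<in> carrier_mat (Suc m) (Suc m)" using F(1) by simp
  show ?thesis
    unfolding F_def[symmetric]
  proof (rule dual_unit_inverse_column[OF F(1)])
    have "det (transpose_mat F) \<noteq> 0"
      by (rule det_upper_triangular_pos[OF Ft F(2)]) (use F(1,3) in auto)
    then show "det F \<noteq> 0" by (simp add: det_transpose[OF F(1)])
    show "F $$ (0, j) = 0" if "j < Suc m" "j \<noteq> 0" for j
      using that F(1) upper_triangularD[OF F(2), of 0 j] by auto
  qed (use F(3) F(4)[unfolded eq_gram_iff[OF F(1)]] in auto)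
qed

section \<open>The inner product and the moment kernel\<close>

definition moment_kernel :: "('d::{finite,linorder}) cspace measure \<Rightarrow> nat \<Rightarrow> nat \<Rightarrow> complex" where
  "moment_kernel \<mu> i j = moment \<mu> (mi_nth i) (mi_nth j)"

abbreviation mono_nth :: "nat \<Rightarrow> ('d::{finite,linorder}) cspace \<Rightarrow> complex" where
  "mono_nth k \<equiv> monomial_fun (mi_nth k)"

lemma continuous_monomial: "continuous_on UNIV (monomial_fun \<alpha>)"
  unfolding monomial_fun_def by (intro continuous_intros)

text \<open>
  Continuous functions are bounded on the compact sphere, which carries the whole measure.
\<close>

lemma integrable_sphere_measure:
  fixes f :: "('d::finite) cspace \<Rightarrow> complex"
  assumes \<mu>: "sphere_measure \<mu>" and f: "continuous_on UNIV f"
  shows "integrable \<mu> f"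
proof -
  interpret finite_measure \<mu> using \<mu> by (simp add: sphere_measure_def)
  have sets: "sets \<mu> = sets (restrict_space borel (sphere 0 1))"
    using \<mu> by (simp add: sphere_measure_def)
  have space: "space \<mu> = sphere 0 1"
    using sets_eq_imp_space_eq[OF sets] by (simp add: space_restrict_space)
  have "f \<in> borel_measurable (restrict_space borel (sphere 0 1))"
    by (intro measurable_restrict_space1 borel_measurable_continuous_onI f)
  then have meas: "f \<in> borel_measurable \<mu>"
    using measurable_cong_sets[OF sets refl] by blast
  have "compact (f ` sphere 0 1)"
    by (intro compact_continuous_image continuous_on_subset[OF f] compact_sphere) simp
  then obtain B where "\<forall>w\<in>f ` sphere 0 1. norm w \<le> B"
    using compact_imp_bounded bounded_iff by blast
  then have "AE z in \<mu>. norm (f z) \<le> B"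
    by (intro AE_I2) (simp add: space)
  then show ?thesis
    using meas by (rule integrable_const_bound)
qed

lemma ip_commute: "ip \<mu> g f = cnj (ip \<mu> f g)"
  unfolding ip_def Bochner_Integration.integral_cnj[symmetric] complex_cnj_mult complex_cnj_cnj
  by (simp only: mult.commute)

lemma ip_sum_left:
  fixes g :: "('d::finite) cspace \<Rightarrow> complex"
  assumes \<mu>: "sphere_measure \<mu>" and f: "\<And>i. i \<in> I \<Longrightarrow> continuous_on UNIV (f i)" and g: "continuous_on UNIV g"
  shows "ip \<mu> (\<lambda>z. \<Sum>i\<in>I. a i * f i z) g = (\<Sum>i\<in>I. a i * ip \<mu> (f i) g)"
proof -
  have int: "integrable \<mu> (\<lambda>z. a i * (f i z * cnj (g z)))" if "i \<in> I" for i
    by (intro integrable_sphere_measure[OF \<mu>] continuous_intros f g that)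
  have "ip \<mu> (\<lambda>z. \<Sum>i\<in>I. a i * f i z) g = (LINT z|\<mu>. (\<Sum>i\<in>I. a i * (f i z * cnj (g z))))"
    by (simp add: ip_def sum_distrib_right mult.assoc)
  also have "\<dots> = (\<Sum>i\<in>I. (LINT z|\<mu>. a i * (f i z * cnj (g z))))"
    by (intro Bochner_Integration.integral_sum int)
  finally show ?thesis by (simp add: ip_def)
qed

lemma ip_sum_right:
  fixes g :: "('d::finite) cspace \<Rightarrow> complex"
  assumes \<mu>: "sphere_measure \<mu>" and f: "\<And>i. i \<in> I \<Longrightarrow> continuous_on UNIV (f i)" and g: "continuous_on UNIV g"
  shows "ip \<mu> g (\<lambda>z. \<Sum>i\<in>I. a i * f i z) = (\<Sum>i\<in>I. cnj (a i) * ip \<mu> g (f i))"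
proof -
  have "ip \<mu> (\<lambda>z. \<Sum>i\<in>I. a i * f i z) g = (\<Sum>i\<in>I. a i * ip \<mu> (f i) g)"
    by (rule ip_sum_left[OF \<mu> f g])
  then show ?thesis
    by (simp add: ip_commute[of \<mu> g])
qed

lemma ip_self:
  fixes f :: "('d::finite) cspace \<Rightarrow> complex"
  shows "ip \<mu> f f = of_real (LINT z|\<mu>. (cmod (f z))\<^sup>2)"
proof -
  have "ip \<mu> f f = (LINT z|\<mu>. complex_of_real ((cmod (f z))\<^sup>2))"
    unfolding ip_def complex_norm_square ..
  then show ?thesis by (simp only: integral_complex_of_real)
qed

lemma ip_self_nonneg: "0 \<le> ip \<mu> f f"
  unfolding ip_self by (simp add: less_eq_complex_def)

text \<open>
  A function of norm zero vanishes almost everywhere and is therefore orthogonal to everything.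
\<close>

lemma ip_self_zero:
  fixes f :: "('d::finite) cspace \<Rightarrow> complex"
  assumes \<mu>: "sphere_measure \<mu>" and f: "continuous_on UNIV f" and null: "ip \<mu> f f = 0"
  shows "ip \<mu> f g = 0"
proof -
  have "integrable \<mu> (\<lambda>z. complex_of_real ((cmod (f z))\<^sup>2))"
    by (intro integrable_sphere_measure[OF \<mu>] continuous_intros f)
  then have "integrable \<mu> (\<lambda>z. (cmod (f z))\<^sup>2)"
    by (simp only: complex_of_real_integrable_eq)
  moreover have "(LINT z|\<mu>. (cmod (f z))\<^sup>2) = 0"
    using null unfolding ip_self by simp
  ultimately have "AE z in \<mu>. (cmod (f z))\<^sup>2 = 0"
    using integral_nonneg_eq_0_iff_AE[of \<mu> "\<lambda>z. (cmod (f z))\<^sup>2"] by simp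
  then have "AE z in \<mu>. f z * cnj (g z) = 0"
    by (rule AE_mp) auto
  then show ?thesis
    unfolding ip_def by (rule integral_eq_zero_AE)
qed

lemma moment_kernel_ip: "moment_kernel \<mu> i j = ip \<mu> (mono_nth j) (mono_nth i)"
  by (simp add: moment_kernel_def moment_def)

lemma hermitian_moment_kernel: "hermitian (moment_kernel \<mu>)"
  unfolding hermitian_def moment_kernel_ip by (intro allI ip_commute)

lemma ip_comb_mono:
  fixes \<mu> :: "('d::{finite,linorder}) cspace measure"
  assumes "sphere_measure \<mu>"
  shows "ip \<mu> (\<lambda>z. \<Sum>k\<in>I. x k * mono_nth k z) (mono_nth r) = (\<Sum>k\<in>I. moment_kernel \<mu> r k * x k)"
  unfolding ip_sum_left[OF assms continuous_monomial continuous_monomial] moment_kernel_ip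
  by (simp add: mult.commute)

lemma ip_comb_self:
  fixes \<mu> :: "('d::{finite,linorder}) cspace measure"
  assumes "sphere_measure \<mu>"
  shows "ip \<mu> (\<lambda>z. \<Sum>k\<in>I. x k * mono_nth k z) (\<lambda>z. \<Sum>k\<in>I. x k * mono_nth k z) =
    (\<Sum>r\<in>I. \<Sum>k\<in>I. cnj (x r) * moment_kernel \<mu> r k * x k)"
proof -
  have "continuous_on UNIV (\<lambda>z :: 'd cspace. \<Sum>k\<in>I. x k * mono_nth k z)"
    by (intro continuous_intros continuous_monomial)
  then have "ip \<mu> (\<lambda>z. \<Sum>k\<in>I. x k * mono_nth k z) (\<lambda>z. \<Sum>k\<in>I. x k * mono_nth k z) =
      (\<Sum>r\<in>I. cnj (x r) * ip \<mu> (\<lambda>z. \<Sum>k\<in>I. x k * mono_nth k z) (mono_nth r))"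
    by (rule ip_sum_right[OF assms continuous_monomial])
  then show ?thesis
    unfolding form_rows ip_comb_mono[OF assms] .
qed

lemma invertible_mat_kernel:
  fixes A :: "complex mat"
  assumes A: "A \<in> carrier_mat n n" "invertible_mat A" and v: "v \<in> carrier_vec n" "A *\<^sub>v v = 0\<^sub>v n"
  shows "v = 0\<^sub>v n"
proof -
  obtain B where B: "A * B = 1\<^sub>m n" "B * A = 1\<^sub>m (dim_row B)"
    using A unfolding invertible_mat_def inverts_mat_def by auto
  have "dim_col (A * B) = n" "dim_col (B * A) = dim_row B"
    using B by simp_all
  then have Bc: "B \<in> carrier_mat n n"
    using A(1) by (intro carrier_matI) auto
  have "v = (B * A) *\<^sub>v v"
    using B(2) Bc v(1) by simp
  also have "\<dots> = B *\<^sub>v (A *\<^sub>v v)"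
    by (rule assoc_mult_mat_vec[OF Bc A(1) v(1)])
  also have "\<dots> = 0\<^sub>v n"
    unfolding v(2) using Bc by (intro eq_vecI) (auto simp: scalar_prod_def)
  finally show ?thesis .
qed

lemma moment_mat_kernel:
  "moment_mat \<mu> i j = Matrix.mat (j + 1 - i) (j + 1 - i) (\<lambda>(r, c). moment_kernel \<mu> (i + r) (i + c))"
  by (simp add: moment_mat_def moment_kernel_def)

text \<open>
  The form at \<open>x\<close> is the squared norm of the polynomial with coefficients \<open>x\<close>. If it vanished,
  the polynomial would be orthogonal to all monomials, and its coefficient vector would lie in the
  kernel of an invertible moment matrix.
\<close>

lemma posdef_moment_kernel:
  fixes \<mu> :: "('d::{finite,linorder}) cspace measure"
  assumes \<mu>: "sphere_measure \<mu>" "nontrivial_measure \<mu>" and I: "finite I" "I \<subseteq> {1..}"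
  shows "posdef_on I (moment_kernel \<mu>)"
  unfolding posdef_on_def
proof (intro allI impI)
  fix x :: "nat \<Rightarrow> complex" assume "\<exists>i\<in>I. x i \<noteq> 0"
  then obtain i where i: "i \<in> I" "x i \<noteq> 0" by blast
  define p where "p = (\<lambda>z :: 'd cspace. \<Sum>k\<in>I. x k * mono_nth k z)"
  have p: "continuous_on UNIV p"
    unfolding p_def by (intro continuous_intros continuous_monomial)
  have "ip \<mu> p p \<noteq> 0"
  proof
    assume "ip \<mu> p p = 0"
    then have row: "(\<Sum>k\<in>I. moment_kernel \<mu> r k * x k) = 0" for r
      using ip_self_zero[OF \<mu>(1) p] unfolding p_def ip_comb_mono[OF \<mu>(1), symmetric] by blast
    define N where "N = Max I"
    have "I \<subseteq> {1..N}"
      using I Max_ge[OF I(1)] by (auto simp: N_def)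
    moreover from this have "1 \<le> N"
      using i(1) by (auto dest!: subsetD)
    ultimately have IN: "I \<subseteq> {1..N}" "1 \<le> N" .
    obtain \<alpha> :: "'d multi_index" where "mi_pos \<alpha> = N"
      using mi_pos_surj[OF IN(2)] by blast
    then have inv: "invertible_mat (moment_mat \<mu> 1 N)"
      using \<mu>(2) unfolding nontrivial_measure_def by blast
    define v where "v = Matrix.vec N (\<lambda>k. if Suc k \<in> I then x (Suc k) else 0)"
    define A where "A = moment_mat \<mu> 1 N"
    have mm: "A = Matrix.mat N N (\<lambda>(r, c). moment_kernel \<mu> (Suc r) (Suc c))"
      by (simp add: A_def moment_mat_kernel)
    have "A *\<^sub>v v = 0\<^sub>v N"
    proof (rule eq_vecI)
      fix r assume "r < dim_vec (0\<^sub>v N :: complex Matrix.vec)"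
      then have r: "r < N" by simp
      have "vec_index (A *\<^sub>v v) r =
          (\<Sum>k\<in>{0..<N}. moment_kernel \<mu> (Suc r) (Suc k) * (if Suc k \<in> I then x (Suc k) else 0))"
        using r by (simp add: mm v_def scalar_prod_def)
      also have "\<dots> = (\<Sum>k\<in>{1..N}. moment_kernel \<mu> (Suc r) k * (if k \<in> I then x k else 0))"
        by (rule sum.reindex_bij_witness[of _ "\<lambda>k. k - 1" Suc]) auto
      also have "\<dots> = (\<Sum>k\<in>I. moment_kernel \<mu> (Suc r) k * x k)"
        by (rule sum.mono_neutral_cong_right) (use IN in auto)
      finally show "vec_index (A *\<^sub>v v) r = vec_index (0\<^sub>v N) r"
        using row r by simp
    qed (simp add: mm)
    moreover have "A \<in> carrier_mat N N" "v \<in> carrier_vec N"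
      by (simp_all add: mm v_def)
    ultimately have "v = 0\<^sub>v N"
      using invertible_mat_kernel inv[folded A_def] by blast
    moreover have "1 \<le> i" "i \<le> N"
      using i(1) IN(1) by auto
    ultimately have "vec_index v (i - 1) = 0"
      by simp
    then show False
      using i \<open>1 \<le> i\<close> \<open>i \<le> N\<close> by (simp add: v_def)
  qed
  then have "0 < ip \<mu> p p"
    using ip_self_nonneg[of \<mu> p] by (simp add: order_less_le)
  then show "0 < (\<Sum>r\<in>I. \<Sum>k\<in>I. cnj (x r) * moment_kernel \<mu> r k * x k)"
    unfolding p_def ip_comb_self[OF \<mu>(1)] .
qed

section \<open>Identification of the polynomials and of the Verblunsky coefficients\<close>

lemma dual_unit_P_vec:
  fixes \<mu> :: "('d::{finite,linorder}) cspace measure"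
  assumes \<mu>: "sphere_measure \<mu>" "nontrivial_measure \<mu>" and ij: "1 \<le> i" "i \<le> j"
  shows "dual_unit (moment_kernel \<mu>) {i..j} j (\<lambda>k. vec_index (P_vec \<mu> i j) (k - i))"
proof -
  define m where "m = j - i"
  define K where "K = (\<lambda>r c. moment_kernel \<mu> (i + r) (i + c))"
  have img: "(\<lambda>k. i + k) ` {..<Suc m} = {i..j}"
  proof (intro equalityI subsetI)
    fix k assume "k \<in> {i..j}"
    then show "k \<in> (\<lambda>k. i + k) ` {..<Suc m}"
      by (intro image_eqI[of _ _ "k - i"]) (auto simp: m_def)
  qed (use ij in \<open>auto simp: m_def\<close>)
  have herm: "hermitian K"
    using hermitian_moment_kernel[of \<mu>] unfolding hermitian_def K_def by blast
  have "posdef_on {i..j} (moment_kernel \<mu>)"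
    using ij(1) by (intro posdef_moment_kernel[OF \<mu>]) auto
  then have pd: "posdef_on {..<Suc m} K"
    unfolding K_def img[symmetric]
    by (rule posdef_on_image[where f = "\<lambda>k. i + k" and g = "\<lambda>k. k - i", rotated]) simp
  have "moment_mat \<mu> i j = Matrix.mat (Suc m) (Suc m) (\<lambda>(r, c). K r c)"
    using ij by (simp add: moment_mat_kernel K_def m_def Suc_diff_le)
  then have "dual_unit K {..<Suc m} m (vec_index (P_vec \<mu> i j))"
    using upper_factor_dual_unit[OF herm pd] by (simp add: P_vec_def m_def)
  then have "dual_unit (moment_kernel \<mu>) ((\<lambda>k. i + k) ` {..<Suc m}) (i + m)
      (\<lambda>k. vec_index (P_vec \<mu> i j) (k - i))"
    unfolding K_def
    by (intro dual_unit_image[where f = "\<lambda>k. i + k" and g = "\<lambda>k. k - i"]) simp_all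
  then show ?thesis
    using ij by (simp only: img) (simp add: m_def)
qed

lemma dual_unit_P_sharp_vec:
  fixes \<mu> :: "('d::{finite,linorder}) cspace measure"
  assumes \<mu>: "sphere_measure \<mu>" "nontrivial_measure \<mu>" and ij: "1 \<le> i" "i \<le> j"
  shows "dual_unit (moment_kernel \<mu>) {i..j} i (\<lambda>k. vec_index (P_sharp_vec \<mu> i j) (k - i))"
proof -
  define m where "m = j - i"
  define K where "K = (\<lambda>r c. moment_kernel \<mu> (i + r) (i + c))"
  have img: "(\<lambda>k. i + k) ` {..<Suc m} = {i..j}"
  proof (intro equalityI subsetI)
    fix k assume "k \<in> {i..j}"
    then show "k \<in> (\<lambda>k. i + k) ` {..<Suc m}"
      by (intro image_eqI[of _ _ "k - i"]) (auto simp: m_def)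
  qed (use ij in \<open>auto simp: m_def\<close>)
  have img': "(\<lambda>k. i + (m - k)) ` {..<Suc m} = {i..j}"
  proof (intro equalityI subsetI)
    fix k assume "k \<in> {i..j}"
    then show "k \<in> (\<lambda>k. i + (m - k)) ` {..<Suc m}"
      by (intro image_eqI[of _ _ "j - k"]) (auto simp: m_def)
  qed (use ij in \<open>auto simp: m_def\<close>)
  have herm: "hermitian K"
    using hermitian_moment_kernel[of \<mu>] unfolding hermitian_def K_def by blast
  have "posdef_on {i..j} (moment_kernel \<mu>)"
    using ij(1) by (intro posdef_moment_kernel[OF \<mu>]) auto
  then have pd: "posdef_on {..<Suc m} (\<lambda>r c. K (m - r) (m - c))"
    unfolding K_def img'[symmetric]
    by (rule posdef_on_image[where f = "\<lambda>k. i + (m - k)" and g = "\<lambda>k. m - (k - i)", rotated]) simp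
  have "moment_mat \<mu> i j = Matrix.mat (Suc m) (Suc m) (\<lambda>(r, c). K r c)"
    using ij by (simp add: moment_mat_kernel K_def m_def Suc_diff_le)
  then have "dual_unit K {..<Suc m} 0 (vec_index (P_sharp_vec \<mu> i j))"
    using lower_factor_dual_unit[OF herm pd] by (simp add: P_sharp_vec_def)
  then have "dual_unit (moment_kernel \<mu>) ((\<lambda>k. i + k) ` {..<Suc m}) (i + 0)
      (\<lambda>k. vec_index (P_sharp_vec \<mu> i j) (k - i))"
    unfolding K_def
    by (intro dual_unit_image[where f = "\<lambda>k. i + k" and g = "\<lambda>k. k - i"]) simp_all
  then show ?thesis
    by (simp only: img) simp
qed

text \<open>
  The Gram--Schmidt step produces a polynomial with coefficient \<open>1\<close> at the \<open>n\<close>-th monomial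
  that is orthogonal to the earlier orthonormal polynomials, hence, by triangularity, to
  the earlier monomials; its inner product with the \<open>n\<close>-th monomial is then its squared norm.
\<close>

lemma orthonormal_seq_dual_unit:
  fixes \<mu> :: "('d::{finite,linorder}) cspace measure"
  assumes \<mu>: "sphere_measure \<mu>" "nontrivial_measure \<mu>" and "1 \<le> n"
  shows "\<exists>x. dual_unit (moment_kernel \<mu>) {1..n} n x \<and>
    orthonormal_seq \<mu> n = (\<lambda>z. \<Sum>k\<in>{1..n}. x k * mono_nth k z)"
  using \<open>1 \<le> n\<close>
proof (induction n rule: less_induct)
  case (less n)
  let ?\<phi> = "orthonormal_seq \<mu>" and ?K = "moment_kernel \<mu>"
  define m where "m = (mono_nth n :: 'd cspace \<Rightarrow> complex)"
  have "\<forall>k\<in>{1..<n}. \<exists>x. dual_unit ?K {1..k} k x \<and> ?\<phi> k = (\<lambda>z. \<Sum>j\<in>{1..k}. x j * mono_nth j z)"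
    using less.IH by auto
  then obtain X where X: "\<And>k. k \<in> {1..<n} \<Longrightarrow> dual_unit ?K {1..k} k (X k)"
    and \<phi>: "\<And>k. k \<in> {1..<n} \<Longrightarrow> ?\<phi> k = (\<lambda>z. \<Sum>j\<in>{1..k}. X k j * mono_nth j z)"
    by metis
  have "\<forall>k\<in>{1..<n}. \<exists>c::real. 0 < c \<and> of_real c * X k k = 1 \<and>
      (\<forall>r\<in>{1..k}. (\<Sum>j\<in>{1..k}. ?K r j * X k j) = (if r = k then of_real c else 0))"
    using X unfolding dual_unit_def by blast
  from bchoice[OF this] obtain c :: "nat \<Rightarrow> real" where cs: "\<forall>k\<in>{1..<n}. 0 < c k \<and> of_real (c k) * X k k = 1 \<and>
      (\<forall>r\<in>{1..k}. (\<Sum>j\<in>{1..k}. ?K r j * X k j) = (if r = k then of_real (c k) else 0))" ..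
  then have c: "\<And>k. k \<in> {1..<n} \<Longrightarrow> 0 < c k"
    "\<And>k. k \<in> {1..<n} \<Longrightarrow> of_real (c k) * X k k = 1"
    and row: "\<And>k r. k \<in> {1..<n} \<Longrightarrow> r \<in> {1..k} \<Longrightarrow>
      (\<Sum>j\<in>{1..k}. ?K r j * X k j) = (if r = k then of_real (c k) else 0)"
    by blast+
  have cont: "continuous_on UNIV (?\<phi> k)" if "k \<in> {1..<n}" for k
    unfolding \<phi>[OF that] by (intro continuous_intros continuous_monomial)
  have ip_right: "ip \<mu> f (?\<phi> k) = (\<Sum>j\<in>{1..k}. cnj (X k j) * ip \<mu> f (mono_nth j))"
    if "k \<in> {1..<n}" "continuous_on UNIV f" for k f
    unfolding \<phi>[OF that(1)] by (rule ip_sum_right[OF \<mu>(1) continuous_monomial that(2)])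
  have ip_mono: "ip \<mu> (?\<phi> k) (mono_nth r) = (if r = k then of_real (c k) else 0)"
    if "k \<in> {1..<n}" "r \<in> {1..k}" for k r
    unfolding \<phi>[OF that(1)] ip_comb_mono[OF \<mu>(1)] by (rule row[OF that])
  have on_le: "ip \<mu> (?\<phi> k) (?\<phi> j) = (if k = j then 1 else 0)"
    if k: "k \<in> {1..<n}" and j: "j \<in> {1..<n}" and "j \<le> k" for k j
  proof -
    have "ip \<mu> (?\<phi> k) (?\<phi> j) = (\<Sum>r\<in>{1..j}. cnj (X j r) * ip \<mu> (?\<phi> k) (mono_nth r))"
      by (rule ip_right[OF j cont[OF k]])
    also have "\<dots> = (\<Sum>r\<in>{1..j}. if r = k then cnj (X k k) * of_real (c k) else 0)"
    proof (rule sum.cong[OF refl])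
      fix r assume r: "r \<in> {1..j}"
      then have "r \<in> {1..k}" using \<open>j \<le> k\<close> by simp
      from ip_mono[OF k this] show "cnj (X j r) * ip \<mu> (?\<phi> k) (mono_nth r) =
          (if r = k then cnj (X k k) * of_real (c k) else 0)"
        using r \<open>j \<le> k\<close> by auto
    qed
    also have "\<dots> = (if k = j then cnj (of_real (c k) * X k k) else 0)"
      using j k \<open>j \<le> k\<close> by (auto simp: mult.commute)
    finally show ?thesis unfolding c(2)[OF k] by simp
  qed
  have on: "ip \<mu> (?\<phi> k) (?\<phi> j) = (if k = j then 1 else 0)"
    if k: "k \<in> {1..<n}" and j: "j \<in> {1..<n}" for k j
  proof (cases "j \<le> k")
    case False
    then show ?thesis
      using on_le[OF j k] by (simp add: ip_commute[of \<mu> "?\<phi> k"])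
  qed (rule on_le[OF k j])
  define a where "a k = ip \<mu> m (?\<phi> k)" for k
  define p where "p = (\<lambda>z. m z - (\<Sum>k\<in>{1..<n}. a k * ?\<phi> k z))"
  define w where "w j = (if j = n then 1 else - (\<Sum>k\<in>{1..<n}. if j \<le> k then a k * X k j else 0))" for j
  have p_comb: "p = (\<lambda>z. \<Sum>j\<in>{1..n}. w j * mono_nth j z)"
  proof
    fix z
    have "(\<Sum>k\<in>{1..<n}. a k * ?\<phi> k z) =
        (\<Sum>k\<in>{1..<n}. \<Sum>j\<in>{1..<n}. (if j \<le> k then a k * X k j else 0) * mono_nth j z)"
    proof (rule sum.cong[OF refl])
      fix k assume k: "k \<in> {1..<n}"
      have "a k * ?\<phi> k z = (\<Sum>j\<in>{1..k}. a k * X k j * mono_nth j z)"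
        unfolding \<phi>[OF k] by (simp add: sum_distrib_left mult.assoc)
      also have "\<dots> = (\<Sum>j\<in>{1..<n}. (if j \<le> k then a k * X k j else 0) * mono_nth j z)"
        by (rule sum.mono_neutral_cong_left) (use k in auto)
      finally show "a k * ?\<phi> k z = \<dots>" .
    qed
    also have "\<dots> = (\<Sum>j\<in>{1..<n}. - w j * mono_nth j z)"
      by (subst sum.swap) (auto simp: w_def sum_distrib_right intro!: sum.cong)
    finally have "p z = w n * mono_nth n z + (\<Sum>j\<in>{1..<n}. w j * mono_nth j z)"
      by (simp add: p_def m_def w_def sum_negf)
    also have "\<dots> = (\<Sum>j\<in>insert n {1..<n}. w j * mono_nth j z)"
      by simp
    also have "insert n {1..<n} = {1..n}"
      using less.prems by auto
    finally show "p z = (\<Sum>j\<in>{1..n}. w j * mono_nth j z)" .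
  qed
  have pc: "continuous_on UNIV p"
    unfolding p_comb by (intro continuous_intros continuous_monomial)
  have p_orth: "ip \<mu> p (?\<phi> j) = 0" if j: "j \<in> {1..<n}" for j
  proof -
    have mc: "continuous_on UNIV m" unfolding m_def by (rule continuous_monomial)
    \<comment> \<open>The free index \<open>0\<close> stands for the monomial, so that linearity applies to a single sum.\<close>
    have p': "p = (\<lambda>z. \<Sum>k\<in>insert 0 {1..<n}. (if k = 0 then 1 else - a k) * (if k = 0 then m else ?\<phi> k) z)"
      by (rule ext) (simp add: p_def sum_negf)
    have "ip \<mu> p (?\<phi> j) = (\<Sum>k\<in>insert 0 {1..<n}. (if k = 0 then 1 else - a k) * ip \<mu> (if k = 0 then m else ?\<phi> k) (?\<phi> j))"
      unfolding p' by (rule ip_sum_left[OF \<mu>(1) _ cont[OF j]]) (use mc cont in auto)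
    also have "\<dots> = a j - (\<Sum>k\<in>{1..<n}. a k * ip \<mu> (?\<phi> k) (?\<phi> j))"
      by (simp add: a_def sum_negf)
    also have "(\<Sum>k\<in>{1..<n}. a k * ip \<mu> (?\<phi> k) (?\<phi> j)) = (\<Sum>k\<in>{1..<n}. if k = j then a j else 0)"
      by (rule sum.cong[OF refl]) (simp add: on[OF _ j])
    also have "\<dots> = a j" using j by simp
    finally show ?thesis by simp
  qed
  have p_mono: "ip \<mu> p (mono_nth r) = 0" if "r \<in> {1..<n}" for r
    using that
  proof (induction r rule: less_induct)
    case (less r)
    have "0 = (\<Sum>j\<in>{1..r}. cnj (X r j) * ip \<mu> p (mono_nth j))"
      using ip_right[OF less.prems pc] p_orth[OF less.prems] by simp
    also have "\<dots> = (\<Sum>j\<in>{1..r}. if j = r then cnj (X r r) * ip \<mu> p (mono_nth r) else 0)"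
      by (rule sum.cong[OF refl]) (use less in auto)
    also have "\<dots> = cnj (X r r) * ip \<mu> p (mono_nth r)"
      using less.prems by simp
    finally show ?case using c(2)[OF less.prems] by auto
  qed
  have wn: "w n = 1" by (simp add: w_def)
  have "0 < ip \<mu> p p"
  proof -
    have "posdef_on {1..n} ?K"
      by (rule posdef_moment_kernel[OF \<mu>]) auto
    moreover have "\<exists>i\<in>{1..n}. w i \<noteq> 0"
      using wn less.prems by (intro bexI[of _ n]) auto
    ultimately show ?thesis
      unfolding p_comb ip_comb_self[OF \<mu>(1)] posdef_on_def by blast
  qed
  then obtain s where s: "0 < s" "ip \<mu> p p = of_real s"
    unfolding pos_complex_iff by blast
  have "ip \<mu> p (mono_nth n) = of_real s"
  proof -
    have "ip \<mu> p p = (\<Sum>j\<in>{1..n}. cnj (w j) * ip \<mu> p (mono_nth j))"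
      by (subst (2) p_comb) (rule ip_sum_right[OF \<mu>(1) continuous_monomial pc])
    also have "\<dots> = (\<Sum>j\<in>{1..n}. if j = n then ip \<mu> p (mono_nth n) else 0)"
      by (rule sum.cong[OF refl]) (auto simp: p_mono wn)
    also have "\<dots> = ip \<mu> p (mono_nth n)"
      using less.prems by simp
    finally show ?thesis using s(2) by simp
  qed
  then have rows: "(\<Sum>k\<in>{1..n}. ?K r k * w k) = (if r = n then of_real s else 0)" if "r \<in> {1..n}" for r
    using that p_mono[of r] unfolding p_comb ip_comb_mono[OF \<mu>(1)] by auto
  have sq: "complex_of_real s / of_real (sqrt s) = of_real (sqrt s)"
    using s(1) by (simp add: real_div_sqrt flip: of_real_divide)
  have "?\<phi> n = (\<lambda>z. p z / csqrt (ip \<mu> p p))"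
    by (subst orthonormal_seq.simps) (simp add: Let_def p_def m_def a_def)
  also have "\<dots> = (\<lambda>z. \<Sum>k\<in>{1..n}. (w k / of_real (sqrt s)) * mono_nth k z)"
    unfolding s(2) using s(1) by (simp add: p_comb sum_divide_distrib)
  finally have "?\<phi> n = (\<lambda>z. \<Sum>k\<in>{1..n}. (w k / of_real (sqrt s)) * mono_nth k z)" .
  moreover have "dual_unit ?K {1..n} n (\<lambda>k. w k / of_real (sqrt s))"
    unfolding dual_unit_def
  proof (intro exI[of _ "sqrt s"] conjI ballI)
    fix r assume "r \<in> {1..n}"
    from rows[OF this] show "(\<Sum>k\<in>{1..n}. ?K r k * (w k / of_real (sqrt s))) = (if r = n then of_real (sqrt s) else 0)"
      by (simp add: sq flip: sum_divide_distrib)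
  qed (use s(1) wn in auto)
  ultimately show ?case by blast
qed

text \<open>
  The Schur complements in the definition of the Verblunsky coefficients can be read off from any
  vector \<open>x\<close>, supported on \<open>e\<close> and the interior, that is orthogonal to the interior basis vectors.
  Its interior part is \<open>- x e\<close> times the inverse of the interior block applied to the \<open>e\<close>-th
  column, and substituting this into the \<open>f\<close>-th row gives \<open>x e\<close> times the Schur complement.
\<close>

lemma schur_complement_dual:
  fixes \<mu> :: "('d::{finite,linorder}) cspace measure" and x :: "nat \<Rightarrow> complex"
  assumes \<mu>: "sphere_measure \<mu>" "nontrivial_measure \<mu>" and ab: "1 \<le> a" "a < b"
    and row: "\<forall>r\<in>{a<..<b}. moment_kernel \<mu> r e * x e + (\<Sum>k\<in>{a<..<b}. moment_kernel \<mu> r k * x k) = 0"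
    and xe: "x e \<noteq> 0"
  shows "moment_kernel \<mu> f e - scalar_prod (Matrix.vec (b - a - 1) (\<lambda>k. moment_kernel \<mu> f (a + 1 + k)))
      (the (mat_inverse (moment_mat \<mu> (a + 1) (b - 1))) *\<^sub>v
        Matrix.vec (b - a - 1) (\<lambda>k. moment_kernel \<mu> (a + 1 + k) e)) =
    (moment_kernel \<mu> f e * x e + (\<Sum>k\<in>{a<..<b}. moment_kernel \<mu> f k * x k)) / x e"
proof -
  let ?K = "moment_kernel \<mu>"
  define s where "s = b - a - 1"
  define M where "M = moment_mat \<mu> (a + 1) (b - 1)"
  have M: "M = Matrix.mat s s (\<lambda>(r, c). ?K (a + 1 + r) (a + 1 + c))"
    using ab by (simp add: M_def s_def moment_mat_kernel Suc_diff_Suc)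
  have Mc: "M \<in> carrier_mat s s" by (simp add: M)
  have sum_shift: "(\<Sum>k\<in>{a<..<b}. g k) = (\<Sum>k<s. g (a + 1 + k))" for g :: "nat \<Rightarrow> complex"
    by (rule sum.reindex_bij_witness[of _ "\<lambda>k. a + 1 + k" "\<lambda>k. k - (a + 1)"])
      (use ab in \<open>auto simp: s_def\<close>)
  have mult: "vec_index (M *\<^sub>v Matrix.vec s g) r = (\<Sum>k<s. ?K (a + 1 + r) (a + 1 + k) * g k)"
    if "r < s" for r g
    using that by (simp add: M scalar_prod_def atLeast0LessThan)
  have "posdef_on {a<..<b} ?K"
    by (rule posdef_moment_kernel[OF \<mu>]) auto
  then have "det M \<noteq> 0"
    unfolding det_0_iff_vec_prod_zero[OF Mc]
  proof (intro notI, elim exE conjE)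
    fix v assume pd: "posdef_on {a<..<b} ?K"
      and v: "v \<in> carrier_vec s" "v \<noteq> 0\<^sub>v s" "M *\<^sub>v v = 0\<^sub>v s"
    have vv: "v = Matrix.vec s (vec_index v)" using v(1) by auto
    have "(\<Sum>k\<in>{a<..<b}. ?K r k * vec_index v (k - (a + 1))) = 0" if r: "r \<in> {a<..<b}" for r
    proof -
      have "r - (a + 1) < s" "a + 1 + (r - (a + 1)) = r" using r by (auto simp: s_def)
      then have "(\<Sum>k<s. ?K r (a + 1 + k) * vec_index v k) = vec_index (M *\<^sub>v v) (r - (a + 1))"
        using mult[of "r - (a + 1)" "vec_index v"] vv by simp
      then show ?thesis
        using v(3) \<open>r - (a + 1) < s\<close> by (simp add: sum_shift)
    qed
    then have z: "vec_index v (k - (a + 1)) = 0" if "k \<in> {a<..<b}" for k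
      using posdef_on_kernel[OF pd, of "\<lambda>k. vec_index v (k - (a + 1))"] that by blast
    have "vec_index v k = 0" if "k < s" for k
      using z[of "a + 1 + k"] that by (auto simp: s_def)
    then have "v = 0\<^sub>v s" using v(1) by (intro eq_vecI) auto
    with v(2) show False ..
  qed
  then have N: "the (mat_inverse M) \<in> carrier_mat s s" "the (mat_inverse M) * M = 1\<^sub>m s"
    using mat_inverse_det[OF Mc] by auto
  define y where "y = Matrix.vec s (\<lambda>k. - x (a + 1 + k) / x e)"
  have "M *\<^sub>v y = Matrix.vec s (\<lambda>k. ?K (a + 1 + k) e)"
  proof (rule eq_vecI)
    fix r assume "r < dim_vec (Matrix.vec s (\<lambda>k. ?K (a + 1 + k) e))"
    then have r: "r < s" by simp
    have "vec_index (M *\<^sub>v y) r = - (\<Sum>k<s. ?K (a + 1 + r) (a + 1 + k) * x (a + 1 + k)) / x e"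
      unfolding y_def mult[OF r] by (simp add: sum_negf sum_divide_distrib)
    also have "\<dots> = ?K (a + 1 + r) e"
    proof -
      have "a + 1 + r \<in> {a<..<b}" using r by (auto simp: s_def)
      from row[rule_format, OF this] have "(\<Sum>k<s. ?K (a + 1 + r) (a + 1 + k) * x (a + 1 + k)) = - (?K (a + 1 + r) e * x e)"
        unfolding sum_shift by (simp only: eq_neg_iff_add_eq_0 add.commute)
      then show ?thesis using xe by simp
    qed
    finally show "vec_index (M *\<^sub>v y) r = vec_index (Matrix.vec s (\<lambda>k. ?K (a + 1 + k) e)) r"
      using r by simp
  qed (simp add: M)
  then have "the (mat_inverse M) *\<^sub>v Matrix.vec s (\<lambda>k. ?K (a + 1 + k) e) = the (mat_inverse M) *\<^sub>v (M *\<^sub>v y)"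
    by simp
  also have "\<dots> = (the (mat_inverse M) * M) *\<^sub>v y"
    by (rule assoc_mult_mat_vec[symmetric, OF N(1) Mc]) (simp add: y_def)
  also have "\<dots> = y"
    unfolding N(2) by (rule one_mult_mat_vec) (simp add: y_def)
  finally have "the (mat_inverse M) *\<^sub>v Matrix.vec s (\<lambda>k. ?K (a + 1 + k) e) = y" .
  moreover have "scalar_prod (Matrix.vec s (\<lambda>k. ?K f (a + 1 + k))) y =
      - (\<Sum>k\<in>{a<..<b}. ?K f k * x k) / x e"
    by (simp add: y_def scalar_prod_def sum_shift atLeast0LessThan sum_negf sum_divide_distrib)
  ultimately show ?thesis
    using xe unfolding M_def[symmetric] s_def[symmetric] by (simp add: add_divide_distrib)
qed

text \<open>
  The right-hand side is the inner product of \<open>y\<close> with \<open>x\<close>. With \<open>c = 1 / x a\<close> and \<open>d = 1 / y b\<close>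
  the radicands are \<open>c\<^sup>2\<close> and \<open>d\<^sup>2\<close>, and the numerator is \<open>d\<close> times the sum on
  the right.
\<close>

lemma verblunsky_dual_unit:
  fixes \<mu> :: "('d::{finite,linorder}) cspace measure" and \<alpha> \<beta> :: "'d multi_index"
  assumes \<mu>: "sphere_measure \<mu>" "nontrivial_measure \<mu>"
  defines "a \<equiv> mi_pos \<alpha>" and "b \<equiv> mi_pos \<beta>"
  assumes less: "a < b"
    and x: "dual_unit (moment_kernel \<mu>) (insert a {a<..<b}) a x"
    and y: "dual_unit (moment_kernel \<mu>) (insert b {a<..<b}) b y"
  shows "verblunsky \<mu> \<alpha> \<beta> = x a * (\<Sum>k\<in>insert b {a<..<b}. moment_kernel \<mu> a k * y k)"
proof -
  let ?K = "moment_kernel \<mu>"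
  have a1: "1 \<le> a" unfolding a_def by (rule mi_pos_ge_1)
  obtain c where c: "0 < c" "of_real c * x a = 1"
    "\<And>r. r \<in> insert a {a<..<b} \<Longrightarrow> (\<Sum>k\<in>insert a {a<..<b}. ?K r k * x k) = (if r = a then of_real c else 0)"
    using x unfolding dual_unit_def by blast
  obtain d where d: "0 < d" "of_real d * y b = 1"
    "\<And>r. r \<in> insert b {a<..<b} \<Longrightarrow> (\<Sum>k\<in>insert b {a<..<b}. ?K r k * y k) = (if r = b then of_real d else 0)"
    using y unfolding dual_unit_def by blast
  have xa: "x a = 1 / of_real c" and yb: "y b = 1 / of_real d"
    using c(1,2) d(1,2) by (simp_all add: field_simps)
  define s where "s = b - a - 1"
  define Minv where "Minv = the (mat_inverse (moment_mat \<mu> (a + 1) (b - 1)))"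
  define u where "u = Matrix.vec s (\<lambda>k. ?K a (a + 1 + k))"
  define v where "v = Matrix.vec s (\<lambda>k. ?K (a + 1 + k) b)"
  define p where "p = (\<Sum>k\<in>insert b {a<..<b}. ?K a k * y k)"
  have "?K b k = cnj (?K k b)" "?K k a = cnj (?K a k)" for k
    using hermitian_moment_kernel[of \<mu>] unfolding hermitian_def by blast+
  then have cu: "conjugate u = Matrix.vec s (\<lambda>k. ?K (a + 1 + k) a)"
    and cv: "conjugate v = Matrix.vec s (\<lambda>k. ?K b (a + 1 + k))"
    by (auto simp: u_def v_def intro!: eq_vecI)
  have insx: "(\<Sum>k\<in>insert a {a<..<b}. ?K r k * x k) = ?K r a * x a + (\<Sum>k\<in>{a<..<b}. ?K r k * x k)" for r
    by simp
  have insy: "(\<Sum>k\<in>insert b {a<..<b}. ?K r k * y k) = ?K r b * y b + (\<Sum>k\<in>{a<..<b}. ?K r k * y k)" for r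
    by simp
  have rowx: "\<forall>r\<in>{a<..<b}. ?K r a * x a + (\<Sum>k\<in>{a<..<b}. ?K r k * x k) = 0"
    using c(3) unfolding insx by auto
  have rowy: "\<forall>r\<in>{a<..<b}. ?K r b * y b + (\<Sum>k\<in>{a<..<b}. ?K r k * y k) = 0"
    using d(3) unfolding insy by auto
  have x0: "x a \<noteq> 0" and y0: "y b \<noteq> 0"
    using c(1) d(1) by (simp_all add: xa yb)
  note schur_x = schur_complement_dual[where x = x and e = a, OF \<mu> a1 less rowx x0, folded s_def Minv_def]
  note schur_y = schur_complement_dual[where x = y and e = b, OF \<mu> a1 less rowy y0, folded s_def Minv_def]
  have sa: "?K a a - scalar_prod u (Minv *\<^sub>v conjugate u) = of_real (c * c)"
    unfolding cu unfolding u_def schur_x using c(3)[of a, unfolded insx] by (simp add: xa)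
  have sb: "?K b b - scalar_prod (conjugate v) (Minv *\<^sub>v v) = of_real (d * d)"
    unfolding cv unfolding v_def schur_y using d(3)[of b, unfolded insy] by (simp add: yb)
  have sab: "?K a b - scalar_prod u (Minv *\<^sub>v v) = p * of_real d"
    unfolding u_def v_def schur_y p_def insy by (simp add: yb)
  \<comment> \<open>For an empty interior the matrices have size \<open>0\<close>, so the quadratic terms vanish by themselves.\<close>
  have form: "(if {\<delta>. \<alpha> \<prec> \<delta> \<and> \<delta> \<prec> \<beta>} = {} then 0 else scalar_prod w (Minv *\<^sub>v w')) = scalar_prod w (Minv *\<^sub>v w')"
    for w w'
  proof (cases "s = 0")
    case True
    then have "moment_mat \<mu> (a + 1) (b - 1) = 1\<^sub>m 0"
      using less by (intro eq_matI) (auto simp: moment_mat_def s_def)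
    then have "Minv \<in> carrier_mat 0 0"
      unfolding Minv_def by (intro mat_inverse_det) auto
    then have "scalar_prod w (Minv *\<^sub>v w') = 0"
      by (simp add: scalar_prod_def)
    then show ?thesis by simp
  next
    case False
    then have "a < mi_pos (mi_nth (a + 1) :: 'd multi_index)" "mi_pos (mi_nth (a + 1) :: 'd multi_index) < b"
      by (auto simp: mi_pos_nth s_def)
    then have "{\<delta>. \<alpha> \<prec> \<delta> \<and> \<delta> \<prec> \<beta>} \<noteq> {}"
      unfolding shortlex_iff_mi_pos a_def b_def by blast
    then show ?thesis by (simp only: if_False)
  qed
  have Ka: "moment \<mu> \<alpha> \<delta> = ?K a (mi_pos \<delta>)" "moment \<mu> \<delta> \<beta> = ?K (mi_pos \<delta>) b"
    "moment \<mu> \<alpha> \<alpha> = ?K a a" "moment \<mu> \<beta> \<beta> = ?K b b" for \<delta>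
    by (simp_all add: moment_kernel_def a_def b_def)
  have "verblunsky_less \<mu> \<alpha> \<beta> = (?K a b - scalar_prod u (Minv *\<^sub>v v)) /
      (csqrt (?K a a - scalar_prod u (Minv *\<^sub>v conjugate u)) * csqrt (?K b b - scalar_prod (conjugate v) (Minv *\<^sub>v v)))"
    unfolding verblunsky_less_def Let_def a_def[symmetric] b_def[symmetric] s_def[symmetric]
      Minv_def[symmetric] form Ka
    by (simp add: u_def v_def mi_pos_nth b_def)
  also have "\<dots> = p * of_real d / (of_real c * of_real d)"
    unfolding sa sb sab using c(1) d(1) by simp
  also have "\<dots> = x a * p"
    using d(1) by (simp add: xa)
  finally have "verblunsky_less \<mu> \<alpha> \<beta> = x a * p" .
  moreover have "\<alpha> \<prec> \<beta>"
    using less by (simp add: shortlex_iff_mi_pos a_def b_def)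
  ultimately show ?thesis
    by (simp add: verblunsky_def p_def)
qed

section \<open>The recursion for orthonormal and sharp polynomials\<close>

theorem theorem3p7:
  fixes \<mu> :: "('d::{finite,linorder}) cspace measure"
    and \<alpha> :: "'d multi_index"
    and z :: "'d cspace"
  assumes "sphere_measure \<mu>"
    and "nontrivial_measure \<mu>"
    and "\<alpha> \<noteq> 0"
  shows "orthonormal_poly \<mu> \<alpha> z =
      1 / of_real (verblunsky_defect \<mu> 0 \<alpha>) *
        (\<Sum>\<beta> | 0 \<preceq> \<beta> \<and> \<beta> \<preceq> mi_prec \<alpha>. e1_coeff \<mu> \<alpha> \<beta> * monomial_fun (mi_succ \<beta>) z)
      - verblunsky \<mu> 0 \<alpha> / of_real (verblunsky_defect \<mu> 0 \<alpha>) * sharp_poly \<mu> (mi_prec \<alpha>) z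
    \<and> sharp_poly \<mu> \<alpha> z =
      - (cnj (verblunsky \<mu> 0 \<alpha>) / of_real (verblunsky_defect \<mu> 0 \<alpha>)) *
        (\<Sum>\<beta> | 0 \<preceq> \<beta> \<and> \<beta> \<preceq> mi_prec \<alpha>. e1_coeff \<mu> \<alpha> \<beta> * monomial_fun (mi_succ \<beta>) z)
      + 1 / of_real (verblunsky_defect \<mu> 0 \<alpha>) * sharp_poly \<mu> (mi_prec \<alpha>) z"
proof -
  let ?K = "moment_kernel \<mu>"
  define n where "n = mi_pos \<alpha>"
  have pos0: "mi_pos (0 :: 'd multi_index) = 1" by (rule mi_pos_zero)
  have "n \<noteq> 1"
    using \<open>\<alpha> \<noteq> 0\<close> pos0 mi_pos_eq_iff[of \<alpha> 0] by (simp add: n_def)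
  then have n: "2 \<le> n"
    using mi_pos_ge_1[of \<alpha>] by (simp add: n_def)
  have prec: "mi_pos (mi_prec \<alpha>) = n - 1"
    using n by (simp add: n_def mi_pos_prec)
  define J where "J = {1<..<n}"
  have J: "finite J" "1 \<notin> J" "n \<notin> J" "1 \<noteq> n"
    and ranges: "insert 1 J = {1..n - 1}" "insert n J = {2..n}" "insert 1 (insert n J) = {1..n}"
    using n by (auto simp: J_def)
  define x where "x = (\<lambda>k. vec_index (P_sharp_vec \<mu> 1 (n - 1)) (k - 1))"
  define y where "y = (\<lambda>k. vec_index (P_vec \<mu> 2 n) (k - 2))"
  have x: "dual_unit ?K (insert 1 J) 1 x"
    using dual_unit_P_sharp_vec[OF assms(1,2), of 1 "n - 1"] n unfolding ranges x_def by simp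
  have y: "dual_unit ?K (insert n J) n y"
    using dual_unit_P_vec[OF assms(1,2), of 2 n] n unfolding ranges y_def by simp
  have pd: "posdef_on (insert 1 (insert n J)) ?K"
    unfolding ranges(3) by (rule posdef_moment_kernel[OF assms(1,2)]) auto
  define g where "g = verblunsky \<mu> 0 \<alpha>"
  define d where "d = verblunsky_defect \<mu> 0 \<alpha>"
  have g: "x 1 * (\<Sum>k\<in>insert n J. ?K 1 k * y k) = g"
    using verblunsky_dual_unit[OF assms(1,2), of 0 \<alpha> x y] x y n
    unfolding g_def J_def pos0 n_def[symmetric] by simp
  have d: "sqrt (1 - (cmod g)\<^sup>2) = d"
    by (simp add: d_def g_def verblunsky_defect_def)
  define x' where "x' = (\<lambda>k. if k = n then 0 else x k)"
  define y' where "y' = (\<lambda>k. if k = 1 then 0 else y k)"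
  note recursion = dual_unit_recursion[OF hermitian_moment_kernel pd J x y, unfolded g d ranges(3)]
  have rec_last: "dual_unit ?K {1..n} n (\<lambda>k. (y' k - g * x' k) / of_real d)"
    unfolding x'_def y'_def by (rule recursion(1))
  have rec_first: "dual_unit ?K {1..n} 1 (\<lambda>k. (x' k - cnj g * y' k) / of_real d)"
    unfolding x'_def y'_def by (rule recursion(2))
  \<comment> \<open>The values at \<open>z\<close> of the polynomial given by \<open>P\<^bsub>2,n\<^esub>\<close> and of the sharp polynomial of \<open>prec(\<alpha>)\<close>.\<close>
  define U where "U = (\<Sum>k\<in>{2..n}. y k * mono_nth k z)"
  define V where "V = (\<Sum>k\<in>{1..n - 1}. x k * mono_nth k z)"
  have sumx: "(\<Sum>k\<in>{1..n}. x' k * mono_nth k z) = V"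
    unfolding V_def by (rule sum.mono_neutral_cong_right) (use n in \<open>auto simp: x'_def\<close>)
  have sumy: "(\<Sum>k\<in>{1..n}. y' k * mono_nth k z) = U"
    unfolding U_def by (rule sum.mono_neutral_cong_right) (use n in \<open>auto simp: y'_def\<close>)
  have sharp_prec: "sharp_poly \<mu> (mi_prec \<alpha>) z = V"
    by (simp add: sharp_poly_def prec V_def x_def)
  have shifted: "(\<Sum>\<beta> | 0 \<preceq> \<beta> \<and> \<beta> \<preceq> mi_prec \<alpha>. e1_coeff \<mu> \<alpha> \<beta> * monomial_fun (mi_succ \<beta>) z) = U"
    unfolding U_def
  proof (rule sum.reindex_bij_witness[of _ "\<lambda>k. mi_nth (k - 1)" "\<lambda>\<beta>. Suc (mi_pos \<beta>)"])
    fix \<beta> :: "'d multi_index" assume "\<beta> \<in> {\<beta>. 0 \<preceq> \<beta> \<and> \<beta> \<preceq> mi_prec \<alpha>}"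
    then have le: "1 \<le> mi_pos \<beta>" "mi_pos \<beta> \<le> n - 1"
      by (simp_all add: shortlex_eq_iff_mi_pos pos0 prec)
    then show "Suc (mi_pos \<beta>) \<in> {2..n}" using n by auto
    show "mi_nth (Suc (mi_pos \<beta>) - 1) = \<beta>" by simp
    have "mi_succ \<beta> = mi_nth (Suc (mi_pos \<beta>))"
      by (simp flip: mi_pos_succ)
    then show "y (Suc (mi_pos \<beta>)) * mono_nth (Suc (mi_pos \<beta>)) z = e1_coeff \<mu> \<alpha> \<beta> * monomial_fun (mi_succ \<beta>) z"
      by (simp add: y_def e1_coeff_def n_def numeral_2_eq_2)
  next
    fix k assume k: "k \<in> {2..n}"
    then have "mi_pos (mi_nth (k - 1) :: 'd multi_index) = k - 1"
      by (intro mi_pos_nth) auto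
    with k show "Suc (mi_pos (mi_nth (k - 1) :: 'd multi_index)) = k"
      and "mi_nth (k - 1) \<in> {\<beta> :: 'd multi_index. 0 \<preceq> \<beta> \<and> \<beta> \<preceq> mi_prec \<alpha>}"
      by (auto simp: shortlex_eq_iff_mi_pos pos0 prec)
  qed
  obtain w where w: "dual_unit ?K {1..n} n w"
    "orthonormal_seq \<mu> n = (\<lambda>z. \<Sum>k\<in>{1..n}. w k * mono_nth k z)"
    using orthonormal_seq_dual_unit[OF assms(1,2), of n] n by auto
  have pd': "posdef_on {1..n} ?K" using pd unfolding ranges(3) .
  have "orthonormal_poly \<mu> \<alpha> z = (\<Sum>k\<in>{1..n}. (y' k - g * x' k) / of_real d * mono_nth k z)"
    unfolding orthonormal_poly_def n_def[symmetric] w(2)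
    using n by (intro sum.cong refl) (subst dual_unit_unique[OF pd' _ w(1) rec_last], simp_all)
  also have "\<dots> = (\<Sum>k\<in>{1..n}. (1 / of_real d) * (y' k * mono_nth k z) - g / of_real d * (x' k * mono_nth k z))"
    by (intro sum.cong refl) (simp add: diff_divide_distrib left_diff_distrib)
  also have "\<dots> = 1 / of_real d * U - g / of_real d * V"
    unfolding sum_subtractf sum_distrib_left[symmetric] sumx sumy ..
  finally have first: "orthonormal_poly \<mu> \<alpha> z = 1 / of_real d * U - g / of_real d * V" .
  have xs: "dual_unit ?K {1..n} 1 (\<lambda>k. vec_index (P_sharp_vec \<mu> 1 n) (k - 1))"
    using dual_unit_P_sharp_vec[OF assms(1,2), of 1 n] n by simp
  have "sharp_poly \<mu> \<alpha> z = (\<Sum>k\<in>{1..n}. (x' k - cnj g * y' k) / of_real d * mono_nth k z)"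
    unfolding sharp_poly_def n_def[symmetric]
    using n by (intro sum.cong refl) (subst dual_unit_unique[OF pd' _ xs rec_first], simp_all)
  also have "\<dots> = (\<Sum>k\<in>{1..n}. - (cnj g / of_real d) * (y' k * mono_nth k z) + 1 / of_real d * (x' k * mono_nth k z))"
    by (intro sum.cong refl) (simp add: diff_divide_distrib left_diff_distrib)
  also have "\<dots> = - (cnj g / of_real d) * U + 1 / of_real d * V"
    unfolding sum.distrib sum_distrib_left[symmetric] sumx sumy ..
  finally have "sharp_poly \<mu> \<alpha> z = - (cnj g / of_real d) * U + 1 / of_real d * V" .
  with first show ?thesis
    unfolding shifted sharp_prec g_def d_def by blast
qed

end
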